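(* Let $n\ge 1$ and let $X=(X_1,\ldots,X_n)$ be a centered Gaussian vector with $\mathbb{E} X_i^2=\sigma_i^2$, $\sigma_i>0$, for each $1\le i\le n$, and with positive definite covariance matrix $C$. Let $p$ be a real number such that $p\ge 2\,p(X)$, where $p(X)$ is the decoupling coefficient of $X$. Then for any complex-valued measurable functions $f_1,\ldots,f_n$ on $\mathbb{R}$ such that $f_i\in L^p(\mathbb{R})$ for all $1\le i\le n$, $$\bigg|\,\mathbb{E}\Big(\prod_{i=1}^n f_i(X_i)\Big)\bigg|\ \le\ \frac{2^{\frac n2(1-\frac1p)}\big(\prod_{i=1}^n\sigma_i\big)^{\frac1p}}{\det(C)^{\frac1{2p}}}\ \prod_{i=1}^n\Big(\mathbb{E}\,|f_i(X_i)|^p\Big)^{\frac1p}.$$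
   Context: For a centered Gaussian vector $X=(X_1,\ldots,X_n)$ with non-degenerate components (i.e. $\mathbb{E}X_i^2>0$ for all $i$), the decoupling coefficient of $X$ is $$p(X)=\max_{1\le i\le n}\ \sum_{1\le j\le n}\frac{|\mathbb{E}X_iX_j|}{\mathbb{E}X_i^2}$$ (the term $j=i$, equal to $1$, is included in the sum). The covariance matrix of $X$ is $C=\{\mathbb{E}X_iX_j\}_{i,j=1}^n$. $L^p(\mathbb{R})$ is taken with respect to Lebesgue measure. *)

theory Defs
  imports "HOL-Probability.Probability"
begin

(* The constant 0 is a degenerate Gaussian; it has no Lebesgue density and
   is therefore listed separately. *)
definition centered_gaussian :: "'a measure \<Rightarrow> ('a \<Rightarrow> real) \<Rightarrow> bool" where
  "centered_gaussian M Y \<longleftrightarrow> Y \<in> borel_measurable M \<and>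
     ((AE \<omega> in M. Y \<omega> = 0) \<or> (\<exists>\<sigma>>0. distributed M lborel Y (normal_density 0 \<sigma>)))"

definition centered_gaussian_vector :: "'a measure \<Rightarrow> ('a \<Rightarrow> real ^ 'n) \<Rightarrow> bool" where
  "centered_gaussian_vector M X \<longleftrightarrow> X \<in> borel_measurable M \<and>
     (\<forall>a :: real ^ 'n. centered_gaussian M (\<lambda>\<omega>. \<Sum>i\<in>UNIV. a $ i * X \<omega> $ i))"

(* This is the matrix of second moments, hence the covariance matrix for centered X only. *)
definition covariance_matrix :: "'a measure \<Rightarrow> ('a \<Rightarrow> real ^ 'n) \<Rightarrow> real ^ 'n ^ 'n" where
  "covariance_matrix M X = (\<chi> i j. \<integral>\<omega>. X \<omega> $ i * X \<omega> $ j \<partial>M)"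

definition positive_definite :: "real ^ 'n ^ 'n \<Rightarrow> bool" where
  "positive_definite A \<longleftrightarrow> transpose A = A \<and> (\<forall>x. x \<noteq> 0 \<longrightarrow> x \<bullet> (A *v x) > 0)"

definition decoupling_coefficient :: "'a measure \<Rightarrow> ('a \<Rightarrow> real ^ 'n) \<Rightarrow> real" where
  "decoupling_coefficient M X =
     (MAX i. \<Sum>j\<in>UNIV. \<bar>\<integral>\<omega>. X \<omega> $ i * X \<omega> $ j \<partial>M\<bar> / (\<integral>\<omega>. (X \<omega> $ i)\<^sup>2 \<partial>M))"

definition Lp_real :: "real \<Rightarrow> (real \<Rightarrow> complex) set" where
  "Lp_real p = {f. f \<in> borel_measurable borel \<and> integrable lborel (\<lambda>x. norm (f x) powr p)}"

end

theory Submission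
  imports Defs
begin

text \<open>
  Write $P$ for the decoupling coefficient of $X$, $C$ for its covariance matrix and $n$ for its
  dimension. Positive definiteness gives a factorization $C = A A^T$ with $A$ invertible, and then
  $X$ has the law of $A Y$ for a standard Gaussian vector $Y$
  (\<open>gaussian_vector_linear_image\<close>). The expectation becomes an integral against $e^{-|y|^2/2}$,
  and the proof is Hoelder's inequality for a suitable splitting of this weight.

  The splitting comes from diagonal dominance. By definition of $P$ the absolute row sums of $C$ are
  at most $P \sigma_i^2$, so $z^T C z \le P \sum_i \sigma_i^2 z_i^2$ for all $z$
  (\<open>quadratic_form_row_sum_bound\<close>). Dually, as $P \le p/2$,
  $\sum_i (Ay)_i^2 / \sigma_i^2 \le \frac{p}{2} |y|^2$ (\<open>weighted_norm_factor_bound\<close>).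
  Let $\gamma_i$ be the density of $X_i$ and $g_i = |f_i| \gamma_i^{1/p}$, so that
  $\int g_i^p = E|f_i(X_i)|^p$. Multiplying and dividing by the $\gamma_i^{1/p}$ costs the factor
  $\exp(\frac{1}{2p} \sum_i (Ay)_i^2/\sigma_i^2) \le e^{|y|^2/4}$, which is only half of the
  available Gaussian decay. Hence, up to constants,
  \[ E \prod_i |f_i(X_i)| \le \int \Big(\prod_i g_i((Ay)_i)\Big) e^{-|y|^2/4} \, dy. \]
  Hoelder's inequality with exponents $p$ and $q = p/(p-1)$ separates the two factors. The
  substitution $x = Ay$ turns the first into $|\det A|^{-1/p} \prod_i (\int g_i^p)^{1/p}$, where
  $|\det A| = \sqrt{\det C}$; the second is at most $(4\pi)^{\frac{n}{2}(1-1/p)}$. Compared with the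
  normalizing factor $(2\pi)^{-\frac{n}{2}(1-1/p)}$, this is the power of $2$ in the claim
  (\<open>nn_integral_std_gaussian_prod_le\<close>).

  Since a Gaussian vector is given only through its one-dimensional projections, identifying its law
  requires that a finite measure on $R^n$ be determined by its characteristic function
  (\<open>measure_eqI_char_vec\<close>). This is derived from the one-dimensional uniqueness theorem by
  treating the coordinates one at a time.
\<close>

section \<open>Lebesgue measure on real vectors as a product measure\<close>

lemma borel_measurable_vec_nth [measurable]:
  "(\<lambda>x :: real ^ 'n. x $ i) \<in> borel_measurable borel"
  by (intro borel_measurable_continuous_onI continuous_intros)

lemma borel_measurable_vec_lambda:
  fixes f :: "'n::finite \<Rightarrow> 'a \<Rightarrow> real"
  assumes [measurable]: "\<And>i. f i \<in> borel_measurable M"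
  shows "(\<lambda>x. \<chi> i. f i x) \<in> borel_measurable M"
proof -
  have "(\<lambda>x. \<chi> i. f i x) = (\<lambda>x. \<Sum>i\<in>UNIV. f i x *\<^sub>R axis i (1::real))"
    by (auto simp: vec_eq_iff axis_def if_distrib cong: if_cong)
  then show ?thesis by simp
qed

lemma measurable_vec_lambda_PiM [measurable]:
  assumes [measurable_cong]: "\<And>i. sets (N i) = sets (borel :: real measure)"
  shows "vec_lambda \<in> borel_measurable (Pi\<^sub>M (UNIV :: 'n::finite set) N)"
  using borel_measurable_vec_lambda[of "\<lambda>i f. f i" "Pi\<^sub>M UNIV N"] by simp

lemma bij_betw_axis_Basis: "bij_betw (\<lambda>i::'n::finite. axis i (1::real)) UNIV Basis"
  by (auto simp: bij_betw_def inj_on_def axis_eq_axis Basis_vec_def)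

lemma prod_Basis_vec:
  fixes F :: "real ^ 'n \<Rightarrow> 'b::comm_monoid_mult"
  shows "prod F Basis = (\<Prod>i\<in>UNIV. F (axis i 1))"
  using prod.reindex_bij_betw[OF bij_betw_axis_Basis, of F] by simp

lemma lborel_vec_eq_PiM:
  "(lborel :: (real ^ 'n) measure) = distr (\<Pi>\<^sub>M i\<in>UNIV. lborel) borel vec_lambda"
proof (rule lborel_eqI)
  interpret product_sigma_finite "\<lambda>i::'n. lborel :: real measure" ..
  fix l u :: "real ^ 'n"
  assume "\<And>b. b \<in> Basis \<Longrightarrow> l \<bullet> b \<le> u \<bullet> b"
  from this[of "axis _ 1"] have le: "l $ i \<le> u $ i" for i
    by (auto simp: inner_axis Basis_vec_def)
  have "vec_lambda -` box l u \<inter> space (\<Pi>\<^sub>M i\<in>(UNIV::'n set). lborel)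
      = (\<Pi>\<^sub>E i\<in>UNIV. {l $ i <..< u $ i})"
    by (auto simp: mem_box_cart space_PiM PiE_iff)
  then have "emeasure (distr (\<Pi>\<^sub>M i\<in>UNIV. lborel) borel vec_lambda) (box l u)
      = (\<Prod>i\<in>UNIV. emeasure lborel {l $ i <..< u $ i})"
    by (simp add: emeasure_distr emeasure_PiM)
  also have "\<dots> = ennreal (\<Prod>i\<in>UNIV. u $ i - l $ i)"
    using le by (simp add: prod_ennreal)
  finally show "emeasure (distr (\<Pi>\<^sub>M i\<in>UNIV. lborel) borel vec_lambda) (box l u)
      = ennreal (\<Prod>b\<in>Basis. (u - l) \<bullet> b)"
    by (simp add: prod_Basis_vec inner_axis)
qed simp

lemma nn_integral_lborel_vec:
  assumes [measurable]: "F \<in> borel_measurable (borel :: (real ^ 'n) measure)"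
  shows "(\<integral>\<^sup>+x. F x \<partial>lborel) = (\<integral>\<^sup>+f. F (vec_lambda f) \<partial>(\<Pi>\<^sub>M i\<in>UNIV. lborel))"
  by (subst lborel_vec_eq_PiM) (simp add: nn_integral_distr)

lemma nn_integral_lborel_vec_prod:
  fixes g :: "'n::finite \<Rightarrow> real \<Rightarrow> ennreal"
  assumes [measurable]: "\<And>i. g i \<in> borel_measurable borel"
  shows "(\<integral>\<^sup>+x. (\<Prod>i\<in>UNIV. g i (x $ i)) \<partial>(lborel :: (real ^ 'n) measure))
       = (\<Prod>i\<in>UNIV. \<integral>\<^sup>+x. g i x \<partial>lborel)"
proof -
  interpret product_sigma_finite "\<lambda>i::'n. lborel :: real measure" ..
  show ?thesis
    by (simp add: nn_integral_lborel_vec product_nn_integral_prod)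
qed

section \<open>Linear change of variables\<close>

text \<open>
  By Fubini the coordinate \<open>m\<close> may be integrated first, and for fixed values of the others the shear is
  a translation of that coordinate.
\<close>

lemma nn_integral_lborel_shear:
  fixes m k :: "'n::finite"
  assumes F[measurable]: "F \<in> borel_measurable (borel :: (real ^ 'n) measure)" and "m \<noteq> k"
  shows "(\<integral>\<^sup>+x. F (\<chi> i. if i = m then x $ m + c * x $ k else x $ i) \<partial>lborel) = (\<integral>\<^sup>+x. F x \<partial>lborel)"
proof -
  interpret product_sigma_finite "\<lambda>i::'n. lborel :: real measure" ..
  let ?I = "UNIV - {m}"
  have U: "UNIV = insert m ?I" by auto
  have mm: "(\<lambda>x :: real^'n. \<chi> i. if i = m then x $ m + c * x $ k else x $ i) \<in> borel_measurable borel"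
    by (rule borel_measurable_vec_lambda) auto
  note [measurable] = measurable_compose[OF mm F]
  have fubini: "(\<integral>\<^sup>+x. G x \<partial>lborel)
      = (\<integral>\<^sup>+f. (\<integral>\<^sup>+t. G (vec_lambda (f(m := t))) \<partial>lborel) \<partial>Pi\<^sub>M ?I (\<lambda>_. lborel))"
    if [measurable]: "G \<in> borel_measurable borel" for G :: "real ^ 'n \<Rightarrow> ennreal"
    unfolding nn_integral_lborel_vec[OF that]
    by (subst U, rule product_nn_integral_insert) (auto simp flip: U)
  have "(\<integral>\<^sup>+t. F (\<chi> i. if i = m then t + c * f k else (f(m := t)) i) \<partial>lborel)
      = (\<integral>\<^sup>+t. F (vec_lambda (f(m := t))) \<partial>lborel)" for f
  proof -
    have [measurable]: "(\<lambda>t. F (vec_lambda (f(m := t)))) \<in> borel_measurable borel"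
      by (intro measurable_compose[OF _ F] borel_measurable_vec_lambda) (auto simp: fun_upd_def)
    have "(\<integral>\<^sup>+t. F (vec_lambda (f(m := t))) \<partial>lborel)
        = (\<integral>\<^sup>+t. F (vec_lambda (f(m := t))) \<partial>distr lborel borel ((+) (c * f k)))"
      by (simp only: lborel_distr_plus)
    also have "\<dots> = (\<integral>\<^sup>+t. F (vec_lambda (f(m := c * f k + t))) \<partial>lborel)"
      by (simp add: nn_integral_distr)
    also have "\<dots> = (\<integral>\<^sup>+t. F (\<chi> i. if i = m then t + c * f k else (f(m := t)) i) \<partial>lborel)"
      by (intro nn_integral_cong arg_cong[of _ _ F]) (auto simp: vec_eq_iff)
    finally show ?thesis by simp
  qed
  with \<open>m \<noteq> k\<close> show ?thesis
    by (simp add: fubini cong: if_cong)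
qed

lemma nn_integral_lborel_vec_permute:
  fixes \<pi> :: "'n::finite \<Rightarrow> 'n"
  assumes F[measurable]: "F \<in> borel_measurable (borel :: (real ^ 'n) measure)" and "bij \<pi>"
  shows "(\<integral>\<^sup>+x. F (\<chi> i. x $ \<pi> i) \<partial>lborel) = (\<integral>\<^sup>+x. F x \<partial>lborel)"
proof -
  have mm[measurable]: "(\<lambda>x :: real^'n. \<chi> i. x $ \<pi> i) \<in> borel_measurable borel"
    by (rule borel_measurable_vec_lambda) auto
  have "lborel = distr lborel borel (\<lambda>x :: real^'n. \<chi> i. x $ \<pi> i)"
  proof (rule lborel_eqI)
    fix l u :: "real ^ 'n"
    assume le: "\<And>b. b \<in> Basis \<Longrightarrow> l \<bullet> b \<le> u \<bullet> b"
    have le': "l $ i \<le> u $ i" for i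
      using le[of "axis i 1"] by (simp add: inner_axis)
    let ?r = "\<lambda>x :: real ^ 'n. \<chi> i. x $ inv \<pi> i"
    have "(\<lambda>x. \<chi> i. x $ \<pi> i) -` box l u = box (?r l) (?r u)"
      using \<open>bij \<pi>\<close> by (force simp: mem_box_cart bij_is_surj surj_f_inv_f bij_is_inj inv_f_f
          dest: spec[of _ "inv \<pi> _"] spec[of _ "\<pi> _"])
    moreover have "emeasure lborel (box (?r l) (?r u)) = (\<Prod>b\<in>Basis. (?r u - ?r l) \<bullet> b)"
      using le' by (intro emeasure_lborel_box) (auto simp: Basis_vec_def inner_axis)
    moreover have "(\<Prod>i\<in>UNIV. u $ inv \<pi> i - l $ inv \<pi> i) = (\<Prod>i\<in>UNIV. u $ i - l $ i)"
      using prod.reindex_bij_betw[of "inv \<pi>" UNIV UNIV "\<lambda>i. u $ i - l $ i"] \<open>bij \<pi>\<close>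
      by (simp add: bij_imp_bij_inv)
    ultimately show "emeasure (distr lborel borel (\<lambda>x :: real^'n. \<chi> i. x $ \<pi> i)) (box l u)
        = ennreal (\<Prod>b\<in>Basis. (u - l) \<bullet> b)"
      by (simp add: emeasure_distr prod_Basis_vec inner_axis)
  qed simp
  then have "(\<integral>\<^sup>+x. F x \<partial>lborel) = (\<integral>\<^sup>+x. F x \<partial>distr lborel borel (\<lambda>x :: real^'n. \<chi> i. x $ \<pi> i))"
    by simp
  then show ?thesis
    by (simp add: nn_integral_distr)
qed

lemma nn_integral_lborel_vec_scale:
  fixes c :: "'n::finite \<Rightarrow> real"
  assumes F[measurable]: "F \<in> borel_measurable (borel :: (real ^ 'n) measure)" and c: "\<And>i. c i \<noteq> 0"
  shows "ennreal \<bar>\<Prod>i\<in>UNIV. c i\<bar> * (\<integral>\<^sup>+x. F (\<chi> i. c i * x $ i) \<partial>lborel) = (\<integral>\<^sup>+x. F x \<partial>lborel)"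
proof -
  have mm[measurable]: "(\<lambda>x :: real^'n. \<chi> i. c i * x $ i) \<in> borel_measurable borel"
    by (rule borel_measurable_vec_lambda) auto
  let ?b = "\<lambda>j. \<Sum>i\<in>UNIV. if j = axis i (1::real) then c i else 0"
  let ?T = "\<lambda>x :: real^'n. 0 + (\<Sum>j\<in>Basis. (?b j * (x \<bullet> j)) *\<^sub>R j)"
  have b: "?b (axis i (1::real)) = c i" for i
    by (simp add: axis_eq_axis)
  have T: "?T x = (\<chi> i. c i * x $ i)" for x
  proof -
    have "?T x = (\<Sum>i\<in>UNIV. (?b (axis i 1) * (x \<bullet> axis i 1)) *\<^sub>R axis i 1)"
      unfolding add_0 by (rule sum.reindex_bij_betw[OF bij_betw_axis_Basis, symmetric])
    also have "\<dots> = (\<Sum>i\<in>UNIV. (c i * x $ i) *\<^sub>R axis i 1)"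
      unfolding b by (simp add: inner_axis)
    also have "\<dots> = (\<chi> i. c i * x $ i)"
      by (auto simp: vec_eq_iff axis_def if_distrib cong: if_cong)
    finally show ?thesis .
  qed
  have bn: "?b j \<noteq> 0" if "j \<in> Basis" for j
    using that b c by (auto simp: Basis_vec_def)
  have "lborel = density (distr lborel borel ?T) (\<lambda>_. \<Prod>j\<in>Basis. \<bar>?b j\<bar>)"
    by (rule lborel_affine_euclidean) (use bn in auto)
  also have "(\<Prod>j\<in>Basis. \<bar>?b j\<bar>) = \<bar>\<Prod>i\<in>UNIV. c i\<bar>"
    unfolding prod_Basis_vec b by (simp add: abs_prod)
  finally have "(\<integral>\<^sup>+x. F x \<partial>lborel)
     = (\<integral>\<^sup>+x. F x \<partial>density (distr lborel borel (\<lambda>x. \<chi> i. c i * x $ i)) (\<lambda>_. \<bar>\<Prod>i\<in>UNIV. c i\<bar>))"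
    unfolding T by simp
  then show ?thesis
    by (simp add: nn_integral_density nn_integral_distr nn_integral_cmult)
qed

lemma borel_measurable_matrix_vector_mult [measurable]:
  "(\<lambda>x. A *v x) \<in> borel_measurable (borel :: (real ^ 'n) measure)" for A :: "real ^ 'n ^ 'm"
  by (intro borel_measurable_continuous_onI matrix_vector_mult_linear_continuous_on)

text \<open>
  Both sides are multiplicative in \<open>A\<close>, so it suffices to treat diagonal matrices, transpositions of
  coordinates and shears, which generate all invertible matrices.
\<close>

lemma nn_integral_lborel_matrix:
  fixes A :: "real ^ 'n ^ 'n"
  assumes "F \<in> borel_measurable borel" and "det A \<noteq> 0"
  shows "ennreal \<bar>det A\<bar> * (\<integral>\<^sup>+x. F (A *v x) \<partial>lborel) = (\<integral>\<^sup>+x. F x \<partial>lborel)"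
proof -
  define P where "P A \<longleftrightarrow> (det A \<noteq> 0 \<longrightarrow> (\<forall>F\<in>borel_measurable borel.
     ennreal \<bar>det A\<bar> * (\<integral>\<^sup>+x. F (A *v x) \<partial>lborel) = (\<integral>\<^sup>+x. F x \<partial>lborel)))" for A :: "real ^ 'n ^ 'n"
  have "P A"
  proof (induction A rule: induct_matrix_elementary)
    case (1 A B)
    show ?case
      unfolding P_def
    proof (intro impI ballI)
      fix F :: "real ^ 'n \<Rightarrow> ennreal"
      assume "det (A ** B) \<noteq> 0" and [measurable]: "F \<in> borel_measurable borel"
      then have n: "det A \<noteq> 0" "det B \<noteq> 0" by (auto simp: det_mul)
      have "(\<integral>\<^sup>+x. F x \<partial>lborel) = ennreal \<bar>det A\<bar> * (\<integral>\<^sup>+x. F (A *v x) \<partial>lborel)"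
        using 1 n by (simp add: P_def)
      also have "(\<integral>\<^sup>+x. F (A *v x) \<partial>lborel) = ennreal \<bar>det B\<bar> * (\<integral>\<^sup>+x. F (A *v (B *v x)) \<partial>lborel)"
        using 1(2)[unfolded P_def, rule_format, OF n(2), of "\<lambda>x. F (A *v x)"] by simp
      finally show "ennreal \<bar>det (A ** B)\<bar> * (\<integral>\<^sup>+x. F ((A ** B) *v x) \<partial>lborel) = (\<integral>\<^sup>+x. F x \<partial>lborel)"
        by (simp add: det_mul abs_mult ennreal_mult matrix_vector_mul_assoc mult.assoc)
    qed
  next
    case (2 A i)
    then show ?case
      using det_zero_row(2)[of i A] by (simp add: P_def)
  next
    case (3 A)
    have A: "A *v x = (\<chi> i. A $ i $ i * x $ i)" for x
    proof -
      have "(\<Sum>j\<in>UNIV. A $ i $ j * x $ j) = A $ i $ i * x $ i" for i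
        using 3 by (subst sum.remove[of _ i]) (auto intro!: sum.neutral)
      then show ?thesis by (simp add: matrix_vector_mult_def)
    qed
    show ?case
      unfolding P_def A using nn_integral_lborel_vec_scale[of _ "\<lambda>i. A $ i $ i"]
      by (auto simp: det_diagonal[OF 3])
  next
    case (4 m n)
    let ?t = "Transposition.transpose m n"
    let ?A = "\<chi> i j. mat 1 $ i $ ?t j :: real ^ 'n ^ 'n"
    have A: "?A *v x = (\<chi> i. x $ ?t i)" for x
    proof -
      have "(\<Sum>j\<in>UNIV. mat 1 $ i $ ?t j * x $ j) = (\<Sum>j\<in>UNIV. if j = ?t i then x $ j else 0)" for i
        by (rule sum.cong) (auto simp: mat_def transpose_eq_iff)
      then show ?thesis by (simp add: matrix_vector_mult_def)
    qed
    have "det ?A = sign ?t * det (mat 1 :: real ^ 'n ^ 'n)"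
      using det_permute_columns[of ?t "mat 1 :: real ^ 'n ^ 'n"] by (simp add: permutes_swap_id)
    then have "\<bar>det ?A\<bar> = 1"
      using 4 by (simp add: sign_swap_id)
    then show ?case
      unfolding P_def A using nn_integral_lborel_vec_permute[of _ ?t] by auto
  next
    case (5 m k c)
    let ?A = "\<chi> i j. if i = m \<and> j = k then c else of_bool (i = j) :: real ^ 'n ^ 'n"
    have A: "?A *v x = (\<chi> i. if i = m then x $ m + c * x $ k else x $ i)" for x
    proof -
      have "(\<Sum>j\<in>UNIV. ?A $ i $ j * x $ j) = (if i = m then x $ m + c * x $ k else x $ i)" for i
      proof -
        have "(\<Sum>j\<in>UNIV. ?A $ i $ j * x $ j)
            = (\<Sum>j\<in>UNIV. (if j = i then x $ j else 0) + (if j = k then if i = m then c * x $ j else 0 else 0))"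
          using 5 by (intro sum.cong) auto
        then show ?thesis by (simp add: sum.distrib)
      qed
      then show ?thesis by (simp add: matrix_vector_mult_def)
    qed
    have "?A = (\<chi> i. if i = m then row m (mat 1) + c *s row k (mat 1) else row i (mat 1))"
      using 5 by (auto simp: vec_eq_iff row_def mat_def)
    then have "det ?A = 1"
      using det_row_operation[OF 5, of "mat 1" c] by simp
    then show ?case
      unfolding P_def A using nn_integral_lborel_shear[OF _ 5] by simp
  qed
  then show ?thesis
    using assms by (simp add: P_def)
qed

section \<open>Characteristic functions determine finite measures\<close>

text \<open>
  The total mass is the value of the characteristic function at 0, so Levy's theorem for probability
  measures applies after normalization.
\<close>

lemma finite_measure_eq_char:
  fixes \<mu> \<nu> :: "real measure"
  assumes "finite_measure \<mu>" "finite_measure \<nu>"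
    and [measurable_cong]: "sets \<mu> = sets borel" "sets \<nu> = sets borel"
    and char: "\<And>t. char \<mu> t = char \<nu> t"
  shows "\<mu> = \<nu>"
proof -
  interpret mu: finite_measure \<mu> by fact
  interpret nu: finite_measure \<nu> by fact
  have sp: "space \<mu> = UNIV" "space \<nu> = UNIV"
    using assms by (auto dest: sets_eq_imp_space_eq)
  define m where "m = measure \<mu> UNIV"
  have m: "measure \<nu> UNIV = m"
    using char[of 0] by (simp add: char_def sp m_def)
  show ?thesis
  proof (cases "m = 0")
    case True
    have "emeasure \<mu> A = emeasure \<nu> A" for A
      using emeasure_mono[of A UNIV \<mu>] emeasure_mono[of A UNIV \<nu>] True m
      by (simp add: assms mu.emeasure_eq_measure nu.emeasure_eq_measure m_def measure_le_0_iff)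
    then show ?thesis by (intro measure_eqI) (simp_all add: assms)
  next
    case False
    then have "m > 0" by (simp add: m_def zero_less_measure_iff)
    define N where "N M = density M (\<lambda>_. ennreal (1 / m))" for M :: "real measure"
    have rd: "real_distribution (N M)"
      if "finite_measure M" "sets M = sets borel" "measure M UNIV = m" for M
    proof -
      interpret finite_measure M by fact
      have "space M = UNIV" using that by (auto dest: sets_eq_imp_space_eq)
      moreover have "emeasure M UNIV = ennreal m" using that by (simp add: emeasure_eq_measure)
      ultimately have "prob_space (N M)"
        using \<open>m > 0\<close> that
        by (intro prob_spaceI) (simp add: N_def emeasure_density nn_integral_cmult ennreal_mult'[symmetric])
      then show ?thesis
        by (simp add: real_distribution_def real_distribution_axioms_def N_def that)
    qed
    have ch: "char (N M) t = char M t / m" if "sets M = sets borel" for M t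
    proof -
      note [measurable_cong] = that
      show ?thesis
        using \<open>m > 0\<close> by (simp add: N_def char_def integral_density scaleR_conv_of_real divide_inverse mult.commute)
    qed
    have "N \<mu> = N \<nu>"
      using assms m by (intro Levy_uniqueness rd) (auto simp: ch m_def)
    then have "density (N \<mu>) (\<lambda>_. ennreal m) = density (N \<nu>) (\<lambda>_. ennreal m)" by simp
    then show ?thesis
      using \<open>m > 0\<close> by (simp add: N_def density_density_eq ennreal_mult'[symmetric] density_1)
  qed
qed

text \<open>
  A cosine weight shifts frequencies: with \<open>u = t \<bullet> x\<close> and \<open>s\<close> replaced by \<open>s * x $ j\<close>, the right-hand side
  only involves characters of the vector \<open>x\<close>, whose integrals are known.
\<close>

lemma iexp_mult_cos:
  "complex_of_real (cos (u + \<theta>)) * iexp s = iexp \<theta> / 2 * iexp (u + s) + iexp (- \<theta>) / 2 * iexp (- u + s)"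
proof -
  have "complex_of_real (cos (u + \<theta>)) = (iexp (u + \<theta>) + iexp (- (u + \<theta>))) / 2"
    by (simp add: cos_of_real[symmetric] cos_exp_eq algebra_simps)
  moreover have "iexp (u + \<theta>) * iexp s = iexp \<theta> * iexp (u + s)"
    "iexp (- (u + \<theta>)) * iexp s = iexp (- \<theta>) * iexp (- u + s)"
    by (simp_all add: exp_add[symmetric] algebra_simps)
  ultimately show ?thesis
    by (simp add: distrib_right add_divide_distrib del: of_real_add of_real_minus)
qed

lemma (in finite_measure) finite_measure_density_bounded:
  assumes [measurable]: "g \<in> borel_measurable M" and "\<And>x. g x \<le> c"
  shows "finite_measure (density M (\<lambda>x. ennreal (g x)))"
proof (rule finite_measureI)
  have "emeasure (density M (\<lambda>x. ennreal (g x))) (space M) = (\<integral>\<^sup>+x. ennreal (g x) \<partial>M)"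
    by (simp add: emeasure_density nn_set_integral_space)
  also have "\<dots> \<le> (\<integral>\<^sup>+x. ennreal c \<partial>M)"
    by (intro nn_integral_mono ennreal_leI assms)
  also have "\<dots> < \<infinity>"
    by (simp add: emeasure_eq_measure ennreal_mult_less_top)
  finally show "emeasure (density M (\<lambda>x. ennreal (g x))) (space (density M (\<lambda>x. ennreal (g x)))) \<noteq> \<infinity>"
    by simp
qed

context
  fixes \<mu> \<nu> :: "(real ^ 'n) measure"
  assumes finite: "finite_measure \<mu>" "finite_measure \<nu>"
    and sets[measurable_cong]: "sets \<mu> = sets borel" "sets \<nu> = sets borel"
    and char: "\<And>t. (\<integral>x. iexp (t \<bullet> x) \<partial>\<mu>) = (\<integral>x. iexp (t \<bullet> x) \<partial>\<nu>)"
begin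

lemma integrable_bounded_vec:
  fixes f :: "real ^ 'n \<Rightarrow> 'c::{banach, second_countable_topology}"
  assumes "f \<in> borel_measurable borel" "\<And>x. norm (f x) \<le> c"
  shows "integrable \<mu> f" "integrable \<nu> f"
  using finite assms sets
  by (auto intro!: finite_measure.integrable_const_bound[where B=c] cong: measurable_cong_sets)

text \<open>
  The measures weighted by \<open>1 + cos (t \<bullet> x + \<theta>)\<close> are still nonnegative, so the one-dimensional uniqueness
  theorem applies to the law of one coordinate under them. This is how the coordinate \<open>j\<close> is separated
  from the oscillation in the direction \<open>t\<close> without leaving the realm of positive measures.
\<close>

lemma distr_weighted_coordinate_eq:
  defines "w t \<theta> x \<equiv> 1 + cos (t \<bullet> x + \<theta>)"
  shows "distr (density \<mu> (\<lambda>x. ennreal (w t \<theta> x))) borel (\<lambda>x. x $ j)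
       = distr (density \<nu> (\<lambda>x. ennreal (w t \<theta> x))) borel (\<lambda>x. x $ j)"
proof (rule finite_measure_eq_char)
  have w0: "0 \<le> w t \<theta> x" and w2: "w t \<theta> x \<le> 2" for x
    unfolding w_def using cos_ge_minus_one[of "t \<bullet> x + \<theta>"] cos_le_one[of "t \<bullet> x + \<theta>"] by linarith+
  have wm[measurable]: "w t \<theta> \<in> borel_measurable borel"
    by (simp add: w_def[abs_def])
  have fin: "finite_measure (distr (density M (\<lambda>x. ennreal (w t \<theta> x))) borel (\<lambda>x. x $ j))"
    if "finite_measure M" and [measurable_cong]: "sets M = sets borel" for M
  proof -
    interpret finite_measure M by fact
    have "finite_measure (density M (\<lambda>x. ennreal (w t \<theta> x)))"
      by (rule finite_measure_density_bounded[where c=2]) (use w2 in auto)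
    then show ?thesis
      by (rule finite_measure.finite_measure_distr) simp
  qed
  show "finite_measure (distr (density \<mu> (\<lambda>x. ennreal (w t \<theta> x))) borel (\<lambda>x. x $ j))"
    "finite_measure (distr (density \<nu> (\<lambda>x. ennreal (w t \<theta> x))) borel (\<lambda>x. x $ j))"
    using finite sets by (auto intro: fin)
  fix s
  let ?e = "s *\<^sub>R axis j 1 :: real ^ 'n"
  have "char (distr (density M (\<lambda>x. ennreal (w t \<theta> x))) borel (\<lambda>x. x $ j)) s
      = (\<integral>x. iexp (?e \<bullet> x) \<partial>M) + (iexp \<theta> / 2 * (\<integral>x. iexp ((t + ?e) \<bullet> x) \<partial>M)
          + iexp (- \<theta>) / 2 * (\<integral>x. iexp ((- t + ?e) \<bullet> x) \<partial>M))"
    if "finite_measure M" and [measurable_cong]: "sets M = sets borel" for M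
  proof -
    interpret finite_measure M by fact
    have "char (distr (density M (\<lambda>x. ennreal (w t \<theta> x))) borel (\<lambda>x. x $ j)) s
      = (\<integral>x. w t \<theta> x *\<^sub>R iexp (s * x $ j) \<partial>M)"
      using w0 by (simp add: char_def integral_distr integral_density)
    also have "\<dots> = (\<integral>x. iexp (?e \<bullet> x) + (iexp \<theta> / 2 * iexp ((t + ?e) \<bullet> x)
        + iexp (- \<theta>) / 2 * iexp ((- t + ?e) \<bullet> x)) \<partial>M)"
    proof -
      have "?e \<bullet> x = s * x $ j" for x
        by (simp add: inner_axis')
      then have "w t \<theta> x *\<^sub>R iexp (s * x $ j) = iexp (?e \<bullet> x) + (iexp \<theta> / 2 * iexp ((t + ?e) \<bullet> x)
          + iexp (- \<theta>) / 2 * iexp ((- t + ?e) \<bullet> x))" for x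
        unfolding w_def scaleR_left_distrib scaleR_one
        by (simp only: inner_add_left inner_minus_left scaleR_conv_of_real iexp_mult_cos)
      then show ?thesis by simp
    qed
    also have "\<dots> = (\<integral>x. iexp (?e \<bullet> x) \<partial>M) + (iexp \<theta> / 2 * (\<integral>x. iexp ((t + ?e) \<bullet> x) \<partial>M)
          + iexp (- \<theta>) / 2 * (\<integral>x. iexp ((- t + ?e) \<bullet> x) \<partial>M))"
    proof -
      have "integrable M (\<lambda>x. iexp (a \<bullet> x))" for a
        by (rule integrable_const_bound[where B=1]) simp_all
      then show ?thesis
        by (simp only: Bochner_Integration.integral_add Bochner_Integration.integrable_add
            integrable_mult_right integral_mult_right_zero)
    qed
    finally show ?thesis .
  qed
  from this[OF finite(1) sets(1)] this[OF finite(2) sets(2)]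
  show "char (distr (density \<mu> (\<lambda>x. ennreal (w t \<theta> x))) borel (\<lambda>x. x $ j)) s
      = char (distr (density \<nu> (\<lambda>x. ennreal (w t \<theta> x))) borel (\<lambda>x. x $ j)) s"
    by (simp only: char)
qed simp_all

lemma integral_indicator_cos_eq:
  assumes [measurable]: "B \<in> sets borel"
  shows "(\<integral>x. indicator B (x $ j) * cos (t \<bullet> x + \<theta>) \<partial>\<mu>)
       = (\<integral>x. indicator B (x $ j) * cos (t \<bullet> x + \<theta>) \<partial>\<nu>)"
proof -
  have int: "integrable \<mu> (\<lambda>x. indicator B (x $ j) * cos (t \<bullet> x + \<theta>))"
    "integrable \<nu> (\<lambda>x. indicator B (x $ j) * cos (t \<bullet> x + \<theta>))"
    "integrable \<mu> (\<lambda>x. indicator B (x $ j) :: real)" "integrable \<nu> (\<lambda>x. indicator B (x $ j) :: real)"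
    for t :: "real ^ 'n" and \<theta>
    by (auto intro!: integrable_bounded_vec[where c=1] simp: indicator_def)
  have w0: "0 \<le> 1 + cos (t \<bullet> x + \<theta>)" for t x :: "real ^ 'n" and \<theta>
    using cos_ge_minus_one[of "t \<bullet> x + \<theta>"] by linarith
  have red: "(\<integral>x. indicator B x \<partial>distr (density M (\<lambda>x. ennreal (1 + cos (t \<bullet> x + \<theta>)))) borel (\<lambda>x. x $ j))
      = (\<integral>x. (1 + cos (t \<bullet> x + \<theta>)) * indicator B (x $ j) \<partial>M)"
    if [measurable_cong]: "sets M = sets borel" for M t \<theta>
    by (subst integral_distr, measurable, subst integral_density) (auto simp: w0)
  have "(\<integral>x. (1 + cos (t \<bullet> x + \<theta>)) * indicator B (x $ j) \<partial>\<mu>)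
      = (\<integral>x. (1 + cos (t \<bullet> x + \<theta>)) * indicator B (x $ j) \<partial>\<nu>)" for t \<theta>
    by (rule trans[OF red[OF sets(1), symmetric] trans[OF _ red[OF sets(2)]]])
      (simp only: distr_weighted_coordinate_eq)
  then have *: "(\<integral>x. indicator B (x $ j) \<partial>\<mu>) + (\<integral>x. indicator B (x $ j) * cos (t \<bullet> x + \<theta>) \<partial>\<mu>)
      = (\<integral>x. indicator B (x $ j) \<partial>\<nu>) + (\<integral>x. indicator B (x $ j) * cos (t \<bullet> x + \<theta>) \<partial>\<nu>)" for t \<theta>
    by (simp add: int distrib_left mult.commute)
  \<comment> \<open>With \<open>t = 0\<close> and \<open>\<theta> = \<pi>/2\<close> the cosine vanishes, which leaves the unweighted term.\<close>
  from *[of 0 "pi / 2"] have "(\<integral>x. indicator B (x $ j) \<partial>\<mu>) = (\<integral>x. (indicator B (x $ j) :: real) \<partial>\<nu>)"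
    by simp
  with *[of t \<theta>] show ?thesis by simp
qed

text \<open>
  Equality of characteristic functions is inherited by the restrictions to \<open>{x. x $ j \<in> B}\<close>; this is the
  induction step for the uniqueness theorem.
\<close>

lemma integral_indicator_iexp_eq:
  assumes [measurable]: "B \<in> sets borel"
  shows "(\<integral>x. indicator B (x $ j) *\<^sub>R iexp (t \<bullet> x) \<partial>\<mu>)
       = (\<integral>x. indicator B (x $ j) *\<^sub>R iexp (t \<bullet> x) \<partial>\<nu>)"
proof -
  \<comment> \<open>The phase \<open>- \<pi>/2\<close> turns the cosine into a sine.\<close>
  have eq: "indicator B (x $ j) *\<^sub>R iexp (t \<bullet> x)
     = complex_of_real (indicator B (x $ j) * cos (t \<bullet> x + 0))
     + \<i> * complex_of_real (indicator B (x $ j) * cos (t \<bullet> x + (- pi / 2)))" for x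
    by (simp add: cis_conv_exp[symmetric] complex_eq_iff cos_diff)
  have int: "integrable \<mu> (\<lambda>x. indicator B (x $ j) * cos (t \<bullet> x + \<theta>))"
    "integrable \<nu> (\<lambda>x. indicator B (x $ j) * cos (t \<bullet> x + \<theta>))" for \<theta>
    by (auto intro!: integrable_bounded_vec[where c=1] simp: indicator_def)
  show ?thesis
    unfolding eq using int
    by (simp only: Bochner_Integration.integral_add integrable_mult_right integrable_of_real integral_mult_right_zero
        integral_complex_of_real integral_indicator_cos_eq[OF assms])
qed

end

text \<open>
  Restricting the coordinates in turn to intervals keeps the characteristic functions equal. Once all
  coordinates are restricted, the value at frequency 0 is the measure of a box.
\<close>

lemma measure_eqI_char_vec:
  fixes \<mu> \<nu> :: "(real ^ 'n) measure"
  assumes "finite_measure \<mu>" "finite_measure \<nu>"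
    and [measurable_cong]: "sets \<mu> = sets borel" "sets \<nu> = sets borel"
    and "\<And>t. (\<integral>x. iexp (t \<bullet> x) \<partial>\<mu>) = (\<integral>x. iexp (t \<bullet> x) \<partial>\<nu>)"
  shows "\<mu> = \<nu>"
proof -
  interpret mu: finite_measure \<mu> by fact
  interpret nu: finite_measure \<nu> by fact
  let ?ind = "\<lambda>B S x. (\<Prod>i\<in>S. indicator (B i) (x $ i)) :: real"
  have *: "(\<integral>x. ?ind B S x *\<^sub>R iexp (t \<bullet> x) \<partial>\<mu>) = (\<integral>x. ?ind B S x *\<^sub>R iexp (t \<bullet> x) \<partial>\<nu>)"
    if [measurable]: "\<And>i. B i \<in> sets borel" for B :: "'n \<Rightarrow> real set" and S t
    using finite[of S]
  proof (induction S arbitrary: t rule: finite_induct)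
    case empty
    then show ?case using assms by simp
  next
    case (insert j S)
    have 0: "0 \<le> ?ind B S x" and 1: "?ind B S x \<le> 1" for x
      by (auto intro!: prod_nonneg prod_le_1)
    have fin: "finite_measure (density M (\<lambda>x. ennreal (?ind B S x)))"
      if "finite_measure M" and [measurable_cong]: "sets M = sets borel" for M
    proof -
      interpret finite_measure M by fact
      show ?thesis
        by (rule finite_measure_density_bounded[where c=1]) (use 1 in auto)
    qed
    have "(\<integral>x. indicator (B j) (x $ j) *\<^sub>R iexp (t \<bullet> x) \<partial>density \<mu> (\<lambda>x. ennreal (?ind B S x)))
        = (\<integral>x. indicator (B j) (x $ j) *\<^sub>R iexp (t \<bullet> x) \<partial>density \<nu> (\<lambda>x. ennreal (?ind B S x)))"
      using assms insert.IH 0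
      by (intro integral_indicator_iexp_eq fin) (simp_all add: integral_density)
    then show ?case
      using insert.hyps 0 by (simp add: integral_density mult.commute)
  qed
  show ?thesis
  proof (rule measure_eqI_generator_eq)
    let ?E = "range (\<lambda>(a, b). box a b :: (real ^ 'n) set)"
    show "Int_stable ?E"
      by (auto simp: Int_stable_def box_Int_box)
    show "?E \<subseteq> Pow UNIV" "sets \<mu> = sigma_sets UNIV ?E" "sets \<nu> = sigma_sets UNIV ?E"
      by (simp_all add: borel_eq_box assms)
    let ?A = "\<lambda>n::nat. box (- (real n *\<^sub>R One)) (real n *\<^sub>R One) :: (real ^ 'n) set"
    show "range ?A \<subseteq> ?E" "(\<Union>i. ?A i) = UNIV"
      unfolding UN_box_eq_UNIV by auto
    show "emeasure \<mu> (?A i) \<noteq> \<infinity>" for i by auto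
    show "emeasure \<mu> X = emeasure \<nu> X" if "X \<in> ?E" for X
    proof -
      from that obtain a b where X: "X = box a b" by auto
      have ind: "?ind (\<lambda>i. {a $ i <..< b $ i}) UNIV x = indicator X x" for x
        by (auto simp: X mem_box_cart indicator_def prod_zero_iff)
      have "complex_of_real (measure \<mu> X) = complex_of_real (measure \<nu> X)"
        using *[of "\<lambda>i. {a $ i <..< b $ i}" UNIV 0] X
        by (simp add: ind scaleR_conv_of_real)
      then show ?thesis by (simp add: mu.emeasure_eq_measure nu.emeasure_eq_measure)
    qed
  qed
qed

section \<open>Hoelder's inequality\<close>

lemma nn_integral_Hoelder:
  fixes f g :: "'a \<Rightarrow> real"
  assumes pq: "1 < p" "1 < q" "1 / p + 1 / q = 1"
    and [measurable]: "f \<in> borel_measurable M" "g \<in> borel_measurable M"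
    and f0: "\<And>x. 0 \<le> f x" and g0: "\<And>x. 0 \<le> g x" and U0: "0 \<le> U" and W0: "0 \<le> W"
    and U: "(\<integral>\<^sup>+x. ennreal (f x powr p) \<partial>M) \<le> ennreal U"
    and W: "(\<integral>\<^sup>+x. ennreal (g x powr q) \<partial>M) \<le> ennreal W"
  shows "(\<integral>\<^sup>+x. ennreal (f x * g x) \<partial>M) \<le> ennreal (U powr (1 / p) * W powr (1 / q))"
proof (cases "U = 0 \<or> W = 0")
  case True
  then have "(AE x in M. f x = 0) \<or> (AE x in M. g x = 0)"
  proof
    assume "U = 0"
    then have "AE x in M. ennreal (f x powr p) = 0"
      using U by (subst nn_integral_0_iff_AE[symmetric]) auto
    then show ?thesis by auto
  next
    assume "W = 0"
    then have "AE x in M. ennreal (g x powr q) = 0"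
      using W by (subst nn_integral_0_iff_AE[symmetric]) auto
    then show ?thesis by auto
  qed
  then have "(\<integral>\<^sup>+x. ennreal (f x * g x) \<partial>M) = (\<integral>\<^sup>+x. 0 \<partial>M)"
    by (intro nn_integral_cong_AE) (auto elim: eventually_mono)
  then show ?thesis by simp
next
  case False
  then have pos: "0 < U" "0 < W" using U0 W0 by auto
  \<comment> \<open>Young's inequality is applied to \<open>f\<close> and \<open>g\<close> after division by their norm bounds \<open>U powr (1 / p)\<close> and \<open>W powr (1 / q)\<close>.\<close>
  define c where "c = U powr (1 / p) * W powr (1 / q)"
  have "f x * g x \<le> c * (f x powr p / (p * U) + g x powr q / (q * W))" for x
  proof -
    have "(f x / U powr (1 / p)) * (g x / W powr (1 / q))
        \<le> (f x / U powr (1 / p)) powr p / p + (g x / W powr (1 / q)) powr q / q"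
      using f0 g0 pos by (intro Youngs_inequality pq) auto
    also have "\<dots> = f x powr p / (p * U) + g x powr q / (q * W)"
      using f0 g0 pos pq by (simp add: powr_divide powr_powr field_simps)
    finally show ?thesis
      using pos by (simp add: c_def field_simps)
  qed
  then have "(\<integral>\<^sup>+x. ennreal (f x * g x) \<partial>M)
      \<le> (\<integral>\<^sup>+x. ennreal c * (ennreal (1 / (p * U)) * ennreal (f x powr p) + ennreal (1 / (q * W)) * ennreal (g x powr q)) \<partial>M)"
    using pos pq by (intro nn_integral_mono)
      (auto simp: ennreal_mult'[symmetric] ennreal_plus[symmetric] c_def simp del: ennreal_plus intro!: ennreal_leI)
  also have "\<dots> = ennreal c * (ennreal (1 / (p * U)) * (\<integral>\<^sup>+x. ennreal (f x powr p) \<partial>M)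
      + ennreal (1 / (q * W)) * (\<integral>\<^sup>+x. ennreal (g x powr q) \<partial>M))"
    by (simp add: nn_integral_cmult nn_integral_add)
  also have "\<dots> \<le> ennreal c * (ennreal (1 / (p * U)) * ennreal U + ennreal (1 / (q * W)) * ennreal W)"
    by (intro mult_left_mono add_mono U W) auto
  also have "\<dots> = ennreal (c * (1 / p + 1 / q))"
    using pos pq by (simp add: ennreal_mult'[symmetric] ennreal_plus[symmetric] c_def del: ennreal_plus)
  finally show ?thesis
    by (simp add: pq c_def)
qed

section \<open>Factorization of positive definite matrices\<close>

lemma positive_definite_sym:
  "positive_definite C \<Longrightarrow> x \<bullet> (C *v y) = y \<bullet> (C *v x)"
  by (metis dot_lmul_matrix inner_commute positive_definite_def transpose_matrix_vector)

text \<open>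
  Gram-Schmidt for the inner product \<open>x \<bullet> (C *v y)\<close>: fewer than \<open>CARD('n)\<close> vectors \<open>C *v v i\<close> do not span,
  so some nonzero vector is orthogonal to all of them and can be normalized.
\<close>

lemma positive_definite_orthonormal_family:
  fixes C :: "real ^ 'n ^ 'n"
  assumes pd: "positive_definite C"
  shows "\<exists>v :: 'n \<Rightarrow> real ^ 'n. \<forall>i\<in>S. \<forall>j\<in>S. v i \<bullet> (C *v v j) = of_bool (i = j)"
  using finite[of S]
proof (induction S rule: finite_induct)
  case (insert k S)
  then obtain v :: "'n \<Rightarrow> real ^ 'n" where v: "\<And>i j. i \<in> S \<Longrightarrow> j \<in> S \<Longrightarrow> v i \<bullet> (C *v v j) = of_bool (i = j)"
    by auto
  have "dim ((\<lambda>i. C *v v i) ` S) \<le> card ((\<lambda>i. C *v v i) ` S)"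
    by (rule dim_le_card') (use insert in auto)
  also have "\<dots> \<le> card S"
    using insert by (intro card_image_le)
  also have "\<dots> < CARD('n)"
    using insert by (intro psubset_card_mono) auto
  finally have "dim ((\<lambda>i. C *v v i) ` S) < DIM(real ^ 'n)"
    by simp
  then obtain x where x: "x \<noteq> 0" "\<And>y. y \<in> span ((\<lambda>i. C *v v i) ` S) \<Longrightarrow> orthogonal x y"
    using orthogonal_to_subspace_exists by blast
  have pos: "x \<bullet> (C *v x) > 0"
    using pd x by (simp add: positive_definite_def)
  define u where "u = (1 / sqrt (x \<bullet> (C *v x))) *\<^sub>R x"
  have u: "u \<bullet> (C *v u) = 1"
    using pos by (simp add: u_def matrix_vector_mult_scaleR)
  have uv: "u \<bullet> (C *v v i) = 0" if "i \<in> S" for i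
    using x(2)[of "C *v v i"] that by (simp add: u_def orthogonal_def span_base)
  then have vu: "v i \<bullet> (C *v u) = 0" if "i \<in> S" for i
    using that by (simp add: positive_definite_sym[OF pd])
  show ?case
    by (rule exI[of _ "v(k := u)"]) (use insert.hyps u uv vu v in auto)
qed simp

lemma positive_definite_factorization:
  fixes C :: "real ^ 'n ^ 'n"
  assumes "positive_definite C"
  obtains V :: "real ^ 'n ^ 'n" where "V ** C ** transpose V = mat 1"
proof -
  from positive_definite_orthonormal_family[OF assms, of UNIV]
  obtain v :: "'n \<Rightarrow> real ^ 'n" where v: "\<And>i j. v i \<bullet> (C *v v j) = of_bool (i = j)"
    by auto
  let ?V = "\<chi> i. v i"
  have "(?V ** C ** transpose ?V) $ i $ j = v i \<bullet> (C *v v j)" for i j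
  proof -
    have "(?V ** C ** transpose ?V) $ i $ j = (?V ** (C ** transpose ?V)) $ i $ j"
      by (simp add: matrix_mul_assoc)
    also have "\<dots> = v i \<bullet> (C *v v j)"
      by (simp add: matrix_matrix_mult_def matrix_vector_mult_def inner_vec_def transpose_def)
    finally show ?thesis .
  qed
  then have "?V ** C ** transpose ?V = mat 1"
    by (simp add: vec_eq_iff v mat_def)
  then show ?thesis by (rule that)
qed

section \<open>Laws of Gaussian vectors\<close>

context prob_space
begin

lemma centered_gaussian_square_integrable:
  assumes "centered_gaussian M Y"
  shows "integrable M (\<lambda>\<omega>. (Y \<omega>)\<^sup>2)"
proof -
  have [measurable]: "Y \<in> borel_measurable M"
    using assms by (simp add: centered_gaussian_def)
  consider "AE \<omega> in M. Y \<omega> = 0" | \<sigma> where "\<sigma> > 0" "distributed M lborel Y (normal_density 0 \<sigma>)"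
    using assms by (auto simp: centered_gaussian_def)
  then show ?thesis
  proof cases
    case 1
    then have "integrable M (\<lambda>\<omega>. (Y \<omega>)\<^sup>2) \<longleftrightarrow> integrable M (\<lambda>\<omega>. 0 :: real)"
      by (intro integrable_cong_AE) (auto elim: eventually_mono)
    then show ?thesis by simp
  next
    case 2
    then show ?thesis
      using integrable_normal_moment[of \<sigma> 0 2]
      by (subst distributed_integrable[OF 2(2), of "\<lambda>x. x\<^sup>2", symmetric]) auto
  qed
qed

lemma centered_gaussian_nondegenerate:
  assumes "centered_gaussian M Y" and "expectation (\<lambda>\<omega>. (Y \<omega>)\<^sup>2) = \<sigma>\<^sup>2" and "\<sigma> > 0"
  shows "distributed M lborel Y (normal_density 0 \<sigma>)"
proof -
  have [measurable]: "Y \<in> borel_measurable M"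
    using assms by (simp add: centered_gaussian_def)
  have "\<not> (AE \<omega> in M. Y \<omega> = 0)"
  proof
    assume "AE \<omega> in M. Y \<omega> = 0"
    then have "expectation (\<lambda>\<omega>. (Y \<omega>)\<^sup>2) = expectation (\<lambda>\<omega>. 0)"
      by (intro integral_cong_AE) (auto elim: eventually_mono)
    with assms show False by simp
  qed
  then obtain s where s: "s > 0" "distributed M lborel Y (normal_density 0 s)"
    using assms by (auto simp: centered_gaussian_def)
  have "\<sigma>\<^sup>2 = s\<^sup>2"
    using normal_distributed_variance[OF s] normal_distributed_expectation[OF s] assms by simp
  then have "\<sigma> = s"
    using s assms by simp
  with s show ?thesis by simp
qed

lemma centered_gaussian_char:
  assumes Y: "centered_gaussian M Y"
  shows "(\<integral>\<omega>. iexp (Y \<omega>) \<partial>M) = exp (- expectation (\<lambda>\<omega>. (Y \<omega>)\<^sup>2) / 2)"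
proof -
  have [measurable]: "Y \<in> borel_measurable M"
    using assms by (simp add: centered_gaussian_def)
  show ?thesis
  proof (cases "expectation (\<lambda>\<omega>. (Y \<omega>)\<^sup>2) = 0")
    case True
    then have "AE \<omega> in M. (Y \<omega>)\<^sup>2 = 0"
      using centered_gaussian_square_integrable[OF Y] by (subst integral_nonneg_eq_0_iff_AE[symmetric]) auto
    then have "(\<integral>\<omega>. iexp (Y \<omega>) \<partial>M) = (\<integral>\<omega>. 1 \<partial>M)"
      by (intro integral_cong_AE) (auto elim: eventually_mono)
    with True show ?thesis by (simp add: prob_space)
  next
    case False
    define s where "s = sqrt (expectation (\<lambda>\<omega>. (Y \<omega>)\<^sup>2))"
    have nn: "expectation (\<lambda>\<omega>. (Y \<omega>)\<^sup>2) \<ge> 0" by simp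
    with False have s: "s > 0" by (simp add: s_def order_less_le)
    have s2: "expectation (\<lambda>\<omega>. (Y \<omega>)\<^sup>2) = s\<^sup>2" using nn by (simp add: s_def)
    have "distributed M lborel (\<lambda>\<omega>. (Y \<omega> - 0) / s) std_normal_density"
      using centered_gaussian_nondegenerate[OF Y s2 s] normal_standard_normal_convert[OF s, of Y 0] by simp
    then have "distr M lborel (\<lambda>\<omega>. Y \<omega> / s) = std_normal_distribution"
      by (simp add: distributed_distr_eq_density)
    then have "char (distr M lborel (\<lambda>\<omega>. Y \<omega> / s)) s = exp (- s\<^sup>2 / 2)"
      by (simp add: char_std_normal_distribution)
    then show ?thesis
      using s by (simp add: char_def integral_distr s2)
  qed
qed

end

definition std_gaussian :: "(real ^ 'n) measure" where
  "std_gaussian = density lborel (\<lambda>x. ennreal (\<Prod>i\<in>UNIV. std_normal_density (x $ i)))"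

lemma integral_lborel_vec_prod:
  fixes g :: "'n::finite \<Rightarrow> real \<Rightarrow> complex"
  assumes "\<And>i. integrable lborel (g i)"
  shows "(\<integral>x. (\<Prod>i\<in>UNIV. g i (x $ i)) \<partial>(lborel :: (real ^ 'n) measure)) = (\<Prod>i\<in>UNIV. \<integral>x. g i x \<partial>lborel)"
proof -
  interpret product_sigma_finite "\<lambda>i::'n. lborel :: real measure" ..
  have [measurable]: "g i \<in> borel_measurable borel" for i
    using borel_measurable_integrable[OF assms[of i]] by simp
  show ?thesis
    by (subst lborel_vec_eq_PiM) (simp add: integral_distr product_integral_prod assms)
qed

lemma sets_std_gaussian [measurable_cong]: "sets std_gaussian = sets borel"
  by (simp add: std_gaussian_def)

lemma prob_space_std_gaussian: "prob_space (std_gaussian :: (real ^ 'n) measure)"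
proof (rule prob_spaceI)
  have "emeasure (std_gaussian :: (real ^ 'n) measure) (space std_gaussian)
      = (\<integral>\<^sup>+x. (\<Prod>i\<in>UNIV. ennreal (std_normal_density (x $ i))) \<partial>(lborel :: (real ^ 'n) measure))"
    by (simp add: std_gaussian_def emeasure_density prod_ennreal)
  also have "\<dots> = 1"
    by (subst nn_integral_lborel_vec_prod[where g="\<lambda>_ x. ennreal (std_normal_density x)"])
      (simp_all add: nn_integral_eq_integral)
  finally show "emeasure (std_gaussian :: (real ^ 'n) measure) (space std_gaussian) = 1" .
qed

lemma char_std_gaussian:
  "(\<integral>x. iexp (t \<bullet> x) \<partial>(std_gaussian :: (real ^ 'n) measure)) = exp (- (t \<bullet> t) / 2)"
proof -
  have c: "(\<integral>x. std_normal_density x *\<^sub>R iexp (s * x) \<partial>lborel) = exp (- s\<^sup>2 / 2)" for s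
    using fun_cong[OF char_std_normal_distribution, of s]
    by (simp add: char_def integral_density)
  have i: "integrable lborel (\<lambda>x. std_normal_density x *\<^sub>R iexp (s * x))" for s
    by (rule Bochner_Integration.integrable_bound[OF integrable_normal_density[of 1 0]]) auto
  have "(\<integral>x. iexp (t \<bullet> x) \<partial>(std_gaussian :: (real ^ 'n) measure))
      = (\<integral>x. (\<Prod>i\<in>UNIV. std_normal_density (x $ i)) *\<^sub>R iexp (t \<bullet> x) \<partial>lborel)"
    unfolding std_gaussian_def by (subst integral_density) (auto intro!: prod_nonneg)
  also have "\<dots> = (\<integral>x. (\<Prod>i\<in>UNIV. std_normal_density (x $ i) *\<^sub>R iexp (t $ i * x $ i)) \<partial>lborel)"
    by (intro Bochner_Integration.integral_cong refl)
      (simp add: scaleR_conv_of_real prod.distrib inner_vec_def sum_distrib_left exp_sum[symmetric])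
  also have "\<dots> = (\<Prod>i\<in>UNIV. exp (- (t $ i)\<^sup>2 / 2))"
    by (subst integral_lborel_vec_prod[where g="\<lambda>i x. std_normal_density x *\<^sub>R iexp (t $ i * x)"])
      (simp_all only: i c of_real_prod)
  also have "\<dots> = exp (- (t \<bullet> t) / 2)"
    by (simp add: inner_vec_def exp_sum[symmetric] sum_negf sum_divide_distrib power2_eq_square flip: of_real_prod)
  finally show ?thesis .
qed

lemma (in prob_space) centered_gaussian_vector_expectation:
  fixes X :: "'a \<Rightarrow> real ^ 'n"
  assumes X: "centered_gaussian_vector M X"
  shows "centered_gaussian M (\<lambda>\<omega>. a \<bullet> X \<omega>)"
    and "expectation (\<lambda>\<omega>. (a \<bullet> X \<omega>)\<^sup>2) = a \<bullet> (covariance_matrix M X *v a)"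
proof -
  show g: "centered_gaussian M (\<lambda>\<omega>. a \<bullet> X \<omega>)" for a
    using X by (simp add: centered_gaussian_vector_def inner_vec_def)
  have [measurable]: "X \<in> borel_measurable M"
    using X by (simp add: centered_gaussian_vector_def)
  have sq: "integrable M (\<lambda>\<omega>. (X \<omega> $ i)\<^sup>2)" for i
    using centered_gaussian_square_integrable[OF g[of "axis i 1"]] by (simp add: inner_axis')
  have int: "integrable M (\<lambda>\<omega>. X \<omega> $ i * X \<omega> $ j)" for i j
  proof (rule Bochner_Integration.integrable_bound)
    show "integrable M (\<lambda>\<omega>. (X \<omega> $ i)\<^sup>2 + (X \<omega> $ j)\<^sup>2)" using sq by simp
    have "\<bar>x * y\<bar> \<le> x\<^sup>2 + y\<^sup>2" for x y :: real
    proof -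
      have "2 * (\<bar>x\<bar> * \<bar>y\<bar>) \<le> x\<^sup>2 + y\<^sup>2"
        using sum_squares_bound[of "\<bar>x\<bar>" "\<bar>y\<bar>"] by simp
      moreover have "0 \<le> \<bar>x\<bar> * \<bar>y\<bar>" by simp
      ultimately show ?thesis unfolding abs_mult by linarith
    qed
    then show "AE \<omega> in M. norm (X \<omega> $ i * X \<omega> $ j) \<le> norm ((X \<omega> $ i)\<^sup>2 + (X \<omega> $ j)\<^sup>2)"
      by simp
  qed simp
  have "expectation (\<lambda>\<omega>. (a \<bullet> X \<omega>)\<^sup>2)
      = expectation (\<lambda>\<omega>. \<Sum>i\<in>UNIV. \<Sum>j\<in>UNIV. a $ i * a $ j * (X \<omega> $ i * X \<omega> $ j))"
    by (simp add: inner_vec_def power2_eq_square sum_product ac_simps)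
  also have "\<dots> = (\<Sum>i\<in>UNIV. \<Sum>j\<in>UNIV. a $ i * a $ j * expectation (\<lambda>\<omega>. X \<omega> $ i * X \<omega> $ j))"
    by (simp add: int)
  also have "\<dots> = a \<bullet> (covariance_matrix M X *v a)"
    by (simp add: inner_vec_def matrix_vector_mult_def covariance_matrix_def sum_distrib_left ac_simps)
  finally show "expectation (\<lambda>\<omega>. (a \<bullet> X \<omega>)\<^sup>2) = a \<bullet> (covariance_matrix M X *v a)" .
qed

text \<open>
  The projection of \<open>V *v X\<close> on \<open>t\<close> is the projection of \<open>X\<close> on \<open>transpose V *v t\<close>, a centered Gaussian whose
  variance is \<open>t \<bullet> t\<close> by the hypothesis on \<open>V\<close>.
\<close>

lemma (in prob_space) distr_whitened_gaussian_vector: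
  fixes X :: "'a \<Rightarrow> real ^ 'n" and V :: "real ^ 'n ^ 'n"
  assumes X: "centered_gaussian_vector M X"
    and V: "V ** covariance_matrix M X ** transpose V = mat 1"
  shows "distr M borel (\<lambda>\<omega>. V *v X \<omega>) = std_gaussian"
proof (rule measure_eqI_char_vec)
  have [measurable]: "X \<in> borel_measurable M"
    using X by (simp add: centered_gaussian_vector_def)
  have m[measurable]: "(\<lambda>\<omega>. V *v X \<omega>) \<in> borel_measurable M"
    by measurable
  show "finite_measure (distr M borel (\<lambda>\<omega>. V *v X \<omega>))"
    by (rule finite_measure_distr) simp
  show "finite_measure (std_gaussian :: (real ^ 'n) measure)"
    by (rule prob_space.finite_measure[OF prob_space_std_gaussian])
  fix t :: "real ^ 'n"
  let ?a = "transpose V *v t"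
  have a: "t \<bullet> (V *v x) = ?a \<bullet> x" for x
    by (simp add: dot_lmul_matrix)
  have "?a \<bullet> (covariance_matrix M X *v ?a) = t \<bullet> ((V ** covariance_matrix M X ** transpose V) *v t)"
    by (simp only: a[symmetric] matrix_vector_mul_assoc matrix_mul_assoc)
  then have "expectation (\<lambda>\<omega>. (?a \<bullet> X \<omega>)\<^sup>2) = t \<bullet> t"
    by (simp only: V matrix_vector_mul_lid centered_gaussian_vector_expectation[OF X])
  then have "(\<integral>\<omega>. iexp (?a \<bullet> X \<omega>) \<partial>M) = exp (- (t \<bullet> t) / 2)"
    using centered_gaussian_char[OF centered_gaussian_vector_expectation(1)[OF X, of ?a]] by simp
  then show "(\<integral>x. iexp (t \<bullet> x) \<partial>distr M borel (\<lambda>\<omega>. V *v X \<omega>)) = (\<integral>x. iexp (t \<bullet> x) \<partial>std_gaussian)"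
    by (simp add: integral_distr char_std_gaussian a del: transpose_matrix_vector)
qed (simp_all add: sets_std_gaussian)

section \<open>Diagonal dominance\<close>

text \<open>
  Since \<open>z\<^sub>i z\<^sub>j \<le> (z\<^sub>i\<^sup>2 + z\<^sub>j\<^sup>2) / 2\<close>, and \<open>C\<close> is symmetric, the off-diagonal entries are absorbed into the
  absolute row sums.
\<close>

lemma quadratic_form_row_sum_bound:
  fixes C :: "real ^ 'n ^ 'n"
  assumes sym: "transpose C = C" and row: "\<And>i. (\<Sum>j\<in>UNIV. \<bar>C $ i $ j\<bar>) \<le> r i"
  shows "z \<bullet> (C *v z) \<le> (\<Sum>i\<in>UNIV. r i * (z $ i)\<^sup>2)"
proof -
  have C: "C $ j $ i = C $ i $ j" for i j
    using sym by (metis transpose_def vec_lambda_beta)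
  have "z \<bullet> (C *v z) = (\<Sum>i\<in>UNIV. \<Sum>j\<in>UNIV. C $ i $ j * (z $ i * z $ j))"
    by (simp add: inner_vec_def matrix_vector_mult_def sum_distrib_left ac_simps)
  also have "\<dots> \<le> (\<Sum>i\<in>UNIV. \<Sum>j\<in>UNIV. \<bar>C $ i $ j\<bar> * ((z $ i)\<^sup>2 / 2) + \<bar>C $ i $ j\<bar> * ((z $ j)\<^sup>2 / 2))"
  proof (intro sum_mono)
    fix i j
    have "\<bar>z $ i * z $ j\<bar> \<le> (z $ i)\<^sup>2 / 2 + (z $ j)\<^sup>2 / 2"
      using sum_squares_bound[of "\<bar>z $ i\<bar>" "\<bar>z $ j\<bar>"] by (simp add: abs_mult)
    from mult_left_mono[OF this, of "\<bar>C $ i $ j\<bar>"]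
    have "\<bar>C $ i $ j * (z $ i * z $ j)\<bar> \<le> \<bar>C $ i $ j\<bar> * ((z $ i)\<^sup>2 / 2) + \<bar>C $ i $ j\<bar> * ((z $ j)\<^sup>2 / 2)"
      by (simp only: abs_mult[of "C $ i $ j"] distrib_left abs_ge_zero)
    then show "C $ i $ j * (z $ i * z $ j) \<le> \<bar>C $ i $ j\<bar> * ((z $ i)\<^sup>2 / 2) + \<bar>C $ i $ j\<bar> * ((z $ j)\<^sup>2 / 2)"
      by linarith
  qed
  also have "\<dots> = (\<Sum>i\<in>UNIV. \<Sum>j\<in>UNIV. \<bar>C $ i $ j\<bar> * ((z $ i)\<^sup>2 / 2)) + (\<Sum>j\<in>UNIV. \<Sum>i\<in>UNIV. \<bar>C $ i $ j\<bar> * ((z $ j)\<^sup>2 / 2))"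
    by (subst (3) sum.swap) (simp add: sum.distrib)
  also have "\<dots> = (\<Sum>i\<in>UNIV. (\<Sum>j\<in>UNIV. \<bar>C $ i $ j\<bar>) * (z $ i)\<^sup>2)"
    by (simp add: C sum.distrib[symmetric] sum_distrib_right)
  also have "\<dots> \<le> (\<Sum>i\<in>UNIV. r i * (z $ i)\<^sup>2)"
    by (intro sum_mono mult_right_mono row) simp
  finally show ?thesis .
qed

text \<open>
  With \<open>D\<close> the diagonal matrix of the \<open>d i\<close>, this passes from \<open>A A\<^sup>T \<le> c D\<close> to \<open>A\<^sup>T D\<^sup>-\<^sup>1 A \<le> c\<close>: these say that
  the transpose of \<open>D\<^sup>-\<^sup>1\<^sup>/\<^sup>2 A\<close> and this matrix itself have squared operator norm at most \<open>c\<close>. The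
  proof tests the hypothesis on \<open>z = D\<^sup>-\<^sup>1 A y\<close> and applies the Cauchy-Schwarz inequality.
\<close>

lemma weighted_norm_factor_bound:
  fixes A :: "real ^ 'n ^ 'n"
  assumes "\<And>z. z \<bullet> ((A ** transpose A) *v z) \<le> c * (\<Sum>i\<in>UNIV. d i * (z $ i)\<^sup>2)"
    and d: "\<And>i. d i > 0" and "c \<ge> 0"
  shows "(\<Sum>i\<in>UNIV. ((A *v y) $ i)\<^sup>2 / d i) \<le> c * (y \<bullet> y)"
proof -
  define z where "z = (\<chi> i. (A *v y) $ i / d i)"
  define q where "q = (\<Sum>i\<in>UNIV. ((A *v y) $ i)\<^sup>2 / d i)"
  have q0: "0 \<le> q"
    using d by (auto simp: q_def intro!: sum_nonneg divide_nonneg_pos)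
  let ?w = "transpose A *v z"
  have "?w \<bullet> ?w = z \<bullet> ((A ** transpose A) *v z)"
    by (simp add: dot_lmul_matrix flip: matrix_vector_mul_assoc)
  also have "\<dots> \<le> c * (\<Sum>i\<in>UNIV. d i * (z $ i)\<^sup>2)"
    by fact
  also have "(\<Sum>i\<in>UNIV. d i * (z $ i)\<^sup>2) = q"
    unfolding q_def z_def using d by (intro sum.cong) (auto simp: power2_eq_square field_simps less_le)
  finally have ww: "?w \<bullet> ?w \<le> c * q" .
  have "?w \<bullet> y = z \<bullet> (A *v y)"
    by (simp add: dot_lmul_matrix)
  also have "\<dots> = q"
    by (simp add: q_def z_def inner_vec_def power2_eq_square)
  finally have "q\<^sup>2 = (?w \<bullet> y)\<^sup>2" by simp
  also have "\<dots> \<le> (?w \<bullet> ?w) * (y \<bullet> y)"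
    by (rule Cauchy_Schwarz_ineq)
  also have "\<dots> \<le> c * q * (y \<bullet> y)"
    using ww by (intro mult_right_mono) auto
  finally have "q * q \<le> q * (c * (y \<bullet> y))"
    by (simp add: power2_eq_square ac_simps)
  then have "q \<le> c * (y \<bullet> y)"
    using q0 \<open>c \<ge> 0\<close> by (cases "q = 0") auto
  then show ?thesis by (simp add: q_def)
qed

section \<open>Gaussian integrals\<close>

lemma prod_std_normal_density:
  "(\<Prod>i\<in>UNIV. std_normal_density ((y :: real ^ 'n) $ i)) = (2 * pi) powr (- (real CARD('n) / 2)) * exp (- (y \<bullet> y) / 2)"
proof -
  have "std_normal_density x = (2 * pi) powr (- 1 / 2) * exp (- x\<^sup>2 / 2)" for x
    by (simp add: std_normal_density_def powr_minus powr_half_sqrt field_simps)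
  then show ?thesis
    by (simp add: prod.distrib powr_powr[symmetric] exp_sum[symmetric] inner_vec_def sum_negf
        sum_divide_distrib power2_eq_square powr_realpow[symmetric] powr_powr)
qed

lemma nn_integral_exp_quarter_norm:
  "(\<integral>\<^sup>+y. ennreal (exp (- (y \<bullet> y) / 4)) \<partial>(lborel :: (real ^ 'n) measure)) = ennreal ((4 * pi) powr (real CARD('n) / 2))"
proof -
  have one: "(\<integral>\<^sup>+x. ennreal (exp (- x\<^sup>2 / 4)) \<partial>lborel) = ennreal (sqrt (4 * pi))"
  proof -
    have "exp (- x\<^sup>2 / 4) = sqrt (4 * pi) * normal_density 0 (sqrt 2) x" for x
      by (simp add: normal_density_def)
    then show ?thesis
      by (simp add: ennreal_mult nn_integral_cmult nn_integral_eq_integral)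
  qed
  have "(\<integral>\<^sup>+y. ennreal (exp (- (y \<bullet> y) / 4)) \<partial>(lborel :: (real ^ 'n) measure))
      = (\<integral>\<^sup>+y. (\<Prod>i\<in>UNIV. ennreal (exp (- (y $ i)\<^sup>2 / 4))) \<partial>(lborel :: (real ^ 'n) measure))"
    by (simp add: prod_ennreal exp_sum[symmetric] inner_vec_def sum_negf sum_divide_distrib power2_eq_square)
  also have "\<dots> = ennreal (sqrt (4 * pi)) ^ CARD('n)"
    using one by (subst nn_integral_lborel_vec_prod[where g="\<lambda>_ x. ennreal (exp (- x\<^sup>2 / 4))"]) simp_all
  also have "\<dots> = ennreal ((4 * pi) powr (real CARD('n) / 2))"
    by (simp add: ennreal_power powr_half_sqrt[symmetric] powr_realpow[symmetric] powr_powr)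
  finally show ?thesis .
qed

section \<open>The decoupling inequality\<close>

text \<open>
  If \<open>V C V\<^sup>T = 1\<close> then \<open>V *v X\<close> is standard Gaussian, and \<open>A = V\<^sup>-\<^sup>1\<close> recovers \<open>X\<close> and satisfies \<open>A A\<^sup>T = C\<close>.
\<close>

lemma (in prob_space) gaussian_vector_linear_image:
  fixes X :: "'a \<Rightarrow> real ^ 'n"
  assumes X: "centered_gaussian_vector M X" and pd: "positive_definite (covariance_matrix M X)"
  obtains A :: "real ^ 'n ^ 'n" where "A ** transpose A = covariance_matrix M X" "det A \<noteq> 0"
    "distr M borel X = distr std_gaussian borel (\<lambda>y. A *v y)"
proof -
  define C where "C = covariance_matrix M X"
  obtain V :: "real ^ 'n ^ 'n" where V: "V ** C ** transpose V = mat 1"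
    using positive_definite_factorization[OF pd] unfolding C_def by blast
  from arg_cong[OF V, of det] have "det V \<noteq> 0"
    by (auto simp: det_mul)
  then have "invertible V"
    by (simp add: invertible_det_nz)
  then obtain A where A: "V ** A = mat 1" "A ** V = mat 1"
    unfolding invertible_def by blast
  have [measurable]: "X \<in> borel_measurable M"
    using X by (simp add: centered_gaussian_vector_def)
  have [measurable]: "(\<lambda>\<omega>. V *v X \<omega>) \<in> borel_measurable M"
    by measurable
  show ?thesis
  proof
    have AT: "transpose V ** transpose A = mat 1"
      by (metis A(2) matrix_transpose_mul transpose_mat)
    have "A ** transpose A = A ** (V ** C ** transpose V) ** transpose A"
      by (simp add: V)
    also have "\<dots> = (A ** V) ** C ** (transpose V ** transpose A)"
      by (simp only: matrix_mul_assoc)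
    also have "\<dots> = C"
      by (simp add: A AT)
    finally show "A ** transpose A = covariance_matrix M X"
      by (simp add: C_def)
    from arg_cong[OF A(1), of det] show "det A \<noteq> 0"
      by (auto simp: det_mul)
    have "distr std_gaussian borel (\<lambda>y. A *v y) = distr (distr M borel (\<lambda>\<omega>. V *v X \<omega>)) borel (\<lambda>y. A *v y)"
      using distr_whitened_gaussian_vector[OF X V[unfolded C_def]] by simp
    also have "\<dots> = distr M borel (\<lambda>\<omega>. A *v (V *v X \<omega>))"
      by (subst distr_distr) (simp_all add: comp_def)
    finally show "distr M borel X = distr std_gaussian borel (\<lambda>y. A *v y)"
      by (simp add: matrix_vector_mul_assoc A)
  qed
qed

lemma normal_density_powr:
  assumes "s > 0"
  shows "normal_density 0 s x powr a = (2 * pi) powr (- a / 2) * s powr (- a) * exp (- (a / 2) * (x\<^sup>2 / s\<^sup>2))"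
proof -
  have "normal_density 0 s x = (2 * pi) powr (- 1 / 2) * s powr (- 1) * exp (- (x\<^sup>2 / s\<^sup>2) / 2)"
    using assms by (simp add: normal_density_def powr_minus powr_half_sqrt real_sqrt_mult field_simps)
  then show ?thesis
    by (simp only: powr_mult powr_powr exp_powr_real) (simp add: algebra_simps)
qed

lemma prod_normal_density_powr:
  fixes \<sigma> :: "'n::finite \<Rightarrow> real"
  assumes "\<And>i. \<sigma> i > 0"
  shows "(\<Prod>i\<in>UNIV. normal_density 0 (\<sigma> i) (x i) powr a)
    = (2 * pi) powr (- (a * real CARD('n) / 2)) * (\<Prod>i\<in>UNIV. \<sigma> i) powr (- a)
      * exp (- (a / 2) * (\<Sum>i\<in>UNIV. (x i)\<^sup>2 / (\<sigma> i)\<^sup>2))"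
proof -
  have "(\<Prod>i\<in>UNIV. \<sigma> i powr (- a)) = (\<Prod>i\<in>UNIV. \<sigma> i) powr (- a)"
    by (rule prod_powr_distrib[symmetric])
  then show ?thesis
    using assms by (simp add: normal_density_powr prod.distrib exp_sum[symmetric] sum_distrib_left
        powr_powr powr_realpow[symmetric] ac_simps)
qed

text \<open>
  The analytic core. In \<open>F y * w y\<close> the factor \<open>F\<close> carries the functions together with the \<open>p\<close>-th
  roots of the marginal normal densities, which make its \<open>p\<close>-th power integrate to the moments \<open>G i\<close>, and \<open>w\<close> is the half of the
  Gaussian decay that the hypothesis \<open>ell\<close> leaves over.
\<close>

lemma nn_integral_std_gaussian_prod_le:
  fixes A :: "real ^ 'n ^ 'n" and \<sigma> G :: "'n \<Rightarrow> real" and h :: "'n \<Rightarrow> real \<Rightarrow> real"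
  assumes [measurable]: "\<And>i. h i \<in> borel_measurable borel" and h0: "\<And>i x. 0 \<le> h i x"
    and \<sigma>: "\<And>i. \<sigma> i > 0" and p: "p > 1" and detA: "det A \<noteq> 0"
    and ell: "\<And>y. (\<Sum>i\<in>UNIV. ((A *v y) $ i)\<^sup>2 / (\<sigma> i)\<^sup>2) \<le> p / 2 * (y \<bullet> y)"
    and G0: "\<And>i. 0 \<le> G i"
    and G: "\<And>i. (\<integral>\<^sup>+x. ennreal (normal_density 0 (\<sigma> i) x * h i x powr p) \<partial>lborel) = ennreal (G i)"
  shows "(\<integral>\<^sup>+y. ennreal (\<Prod>i\<in>UNIV. h i ((A *v y) $ i)) \<partial>std_gaussian)
    \<le> ennreal (2 powr (real CARD('n) / 2 * (1 - 1 / p)) * (\<Prod>i\<in>UNIV. \<sigma> i) powr (1 / p)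
          / \<bar>det A\<bar> powr (1 / p) * (\<Prod>i\<in>UNIV. G i powr (1 / p)))"
proof -
  define n where "n = real CARD('n)"
  define S where "S = (\<Prod>i\<in>UNIV. \<sigma> i)"
  have S: "S > 0" using \<sigma> by (auto simp: S_def intro: prod_pos)
  define q where "q = p / (p - 1)"
  have q: "q > 1" and pq: "1 / p + 1 / q = 1" and q': "1 / q = 1 - 1 / p"
    using p by (auto simp: q_def field_simps)
  define g where "g i x = h i x * normal_density 0 (\<sigma> i) x powr (1 / p)" for i x
  have gm[measurable]: "g i \<in> borel_measurable borel" for i
    by (simp add: g_def[abs_def])
  have g0: "0 \<le> g i x" for i x
    by (simp add: g_def h0)
  define F where "F y = (\<Prod>i\<in>UNIV. g i ((A *v y) $ i))" for y
  define w where "w y = exp (- (y \<bullet> y) / 4)" for y :: "real ^ 'n"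
  have Fm[measurable]: "F \<in> borel_measurable borel" and wm[measurable]: "w \<in> borel_measurable borel"
    by (simp_all add: F_def[abs_def] w_def[abs_def])
  have F0: "0 \<le> F y" and w0: "0 \<le> w y" for y
    by (auto simp: F_def w_def g0 intro!: prod_nonneg)
  define K where "K = (2 * pi) powr (- (n / 2 * (1 - 1 / p))) * S powr (1 / p)"
  have K0: "0 \<le> K" by (simp add: K_def)

  have pointwise: "(\<Prod>i\<in>UNIV. std_normal_density (y $ i)) * (\<Prod>i\<in>UNIV. h i ((A *v y) $ i)) \<le> K * (F y * w y)" for y
  proof -
    let ?Q = "\<Sum>i\<in>UNIV. ((A *v y) $ i)\<^sup>2 / (\<sigma> i)\<^sup>2"
    have K_split: "(2 * pi) powr (- (n / 2))
        = K * ((2 * pi) powr (- (1 / p * n / 2)) * S powr (- (1 / p)))"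
    proof -
      have "(2 * pi) powr (- (n / 2)) = (2 * pi) powr (- (n / 2 * (1 - 1 / p))) * (2 * pi) powr (- (1 / p * n / 2))"
      proof -
        have e: "- (n / 2) = - (n / 2 * (1 - 1 / p)) + - (1 / p * n / 2)"
          using p by (simp add: field_simps)
        show ?thesis
          by (subst e) (rule powr_add)
      qed
      moreover have "S powr (1 / p) * S powr (- (1 / p)) = 1"
        using S by (simp add: powr_add[symmetric])
      ultimately show ?thesis by (simp add: K_def)
    qed
    have "?Q / p \<le> (y \<bullet> y) / 2"
      using ell[of y] p by (simp add: field_simps)
    then have "exp (- (y \<bullet> y) / 2) \<le> exp (- (1 / p / 2) * ?Q) * w y"
      by (simp add: w_def exp_add[symmetric])
    then have "(2 * pi) powr (- (n / 2)) * exp (- (y \<bullet> y) / 2)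
        \<le> (2 * pi) powr (- (n / 2)) * (exp (- (1 / p / 2) * ?Q) * w y)"
      by (intro mult_left_mono) auto
    also have "\<dots> = K * ((2 * pi) powr (- (1 / p * n / 2)) * S powr (- (1 / p))) * (exp (- (1 / p / 2) * ?Q) * w y)"
      by (simp only: K_split)
    finally have "(2 * pi) powr (- (n / 2)) * exp (- (y \<bullet> y) / 2)
        \<le> K * (\<Prod>i\<in>UNIV. normal_density 0 (\<sigma> i) ((A *v y) $ i) powr (1 / p)) * w y"
      by (subst prod_normal_density_powr[OF \<sigma>]) (simp only: n_def S_def mult.assoc)
    then have "(2 * pi) powr (- (n / 2)) * exp (- (y \<bullet> y) / 2) * (\<Prod>i\<in>UNIV. h i ((A *v y) $ i))
        \<le> K * (\<Prod>i\<in>UNIV. normal_density 0 (\<sigma> i) ((A *v y) $ i) powr (1 / p)) * w y * (\<Prod>i\<in>UNIV. h i ((A *v y) $ i))"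
      by (intro mult_right_mono prod_nonneg) (auto simp: h0)
    also have "\<dots> = K * (F y * w y)"
      by (simp add: F_def g_def prod.distrib)
    finally show ?thesis
      by (simp add: prod_std_normal_density n_def)
  qed

  have "(\<integral>\<^sup>+y. ennreal (F y powr p) \<partial>lborel) = ennreal ((\<Prod>i\<in>UNIV. G i) / \<bar>det A\<bar>)"
  proof -
    let ?\<Phi> = "\<lambda>x :: real ^ 'n. \<Prod>i\<in>UNIV. ennreal (g i (x $ i) powr p)"
    have "ennreal (F y powr p) = ?\<Phi> (A *v y)" for y
      unfolding F_def by (subst prod_powr_distrib) (auto simp: g0 prod_ennreal)
    then have "ennreal \<bar>det A\<bar> * (\<integral>\<^sup>+y. ennreal (F y powr p) \<partial>lborel) = (\<integral>\<^sup>+x. ?\<Phi> x \<partial>lborel)"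
      using nn_integral_lborel_matrix[OF _ detA, of ?\<Phi>] by simp
    also have "\<dots> = (\<Prod>i\<in>UNIV. \<integral>\<^sup>+x. ennreal (g i x powr p) \<partial>lborel)"
      by (rule nn_integral_lborel_vec_prod) simp
    also have "\<dots> = (\<Prod>i\<in>UNIV. ennreal (G i))"
      using p by (simp add: g_def powr_mult powr_powr h0 G[symmetric] mult.commute)
    also have "\<dots> = ennreal (\<Prod>i\<in>UNIV. G i)"
      by (simp add: prod_ennreal G0)
    finally have "ennreal (1 / \<bar>det A\<bar>) * (ennreal \<bar>det A\<bar> * (\<integral>\<^sup>+y. ennreal (F y powr p) \<partial>lborel))
        = ennreal (1 / \<bar>det A\<bar>) * ennreal (\<Prod>i\<in>UNIV. G i)" by simp
    then show ?thesis
      using detA by (simp add: mult.assoc[symmetric] ennreal_mult'[symmetric])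
  qed
  moreover have "(\<integral>\<^sup>+y. ennreal (w y powr q) \<partial>lborel) \<le> ennreal ((4 * pi) powr (n / 2))"
  proof -
    \<comment> \<open>As \<open>w \<le> 1\<close>, the exponent \<open>q\<close> may be dropped; this replaces the exact constant \<open>2 / q\<close> by \<open>2\<close>.\<close>
    have "w y powr q \<le> w y" for y
    proof -
      have "w y powr q \<le> w y powr 1"
        using q by (intro powr_mono') (auto simp: w_def)
      then show ?thesis by (simp add: w_def)
    qed
    then have "(\<integral>\<^sup>+y. ennreal (w y powr q) \<partial>lborel) \<le> (\<integral>\<^sup>+y. ennreal (w y) \<partial>lborel)"
      by (intro nn_integral_mono ennreal_leI)
    then show ?thesis
      by (simp only: w_def nn_integral_exp_quarter_norm n_def)
  qed
  ultimately have hoelder: "(\<integral>\<^sup>+y. ennreal (F y * w y) \<partial>lborel)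
      \<le> ennreal (((\<Prod>i\<in>UNIV. G i) / \<bar>det A\<bar>) powr (1 / p) * ((4 * pi) powr (n / 2)) powr (1 / q))"
    using p q pq F0 w0 G0 by (intro nn_integral_Hoelder) (auto intro!: divide_nonneg_nonneg prod_nonneg)

  have "(\<integral>\<^sup>+y. ennreal (\<Prod>i\<in>UNIV. h i ((A *v y) $ i)) \<partial>std_gaussian)
      = (\<integral>\<^sup>+y. ennreal ((\<Prod>i\<in>UNIV. std_normal_density (y $ i)) * (\<Prod>i\<in>UNIV. h i ((A *v y) $ i))) \<partial>lborel)"
    unfolding std_gaussian_def
    by (subst nn_integral_density) (auto simp: ennreal_mult' prod_nonneg)
  also have "\<dots> \<le> (\<integral>\<^sup>+y. ennreal K * ennreal (F y * w y) \<partial>lborel)"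
    using pointwise K0 by (intro nn_integral_mono) (simp add: ennreal_mult'[symmetric] ennreal_leI)
  also have "\<dots> = ennreal K * (\<integral>\<^sup>+y. ennreal (F y * w y) \<partial>lborel)"
    by (simp add: nn_integral_cmult)
  also have "\<dots> \<le> ennreal K * ennreal (((\<Prod>i\<in>UNIV. G i) / \<bar>det A\<bar>) powr (1 / p) * ((4 * pi) powr (n / 2)) powr (1 / q))"
    by (intro mult_left_mono hoelder) simp
  also have "\<dots> = ennreal (K * (((\<Prod>i\<in>UNIV. G i) / \<bar>det A\<bar>) powr (1 / p) * ((4 * pi) powr (n / 2)) powr (1 / q)))"
    using K0 by (simp add: ennreal_mult')
  also have "K * (((\<Prod>i\<in>UNIV. G i) / \<bar>det A\<bar>) powr (1 / p) * ((4 * pi) powr (n / 2)) powr (1 / q))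
      = 2 powr (n / 2 * (1 - 1 / p)) * S powr (1 / p) / \<bar>det A\<bar> powr (1 / p) * (\<Prod>i\<in>UNIV. G i powr (1 / p))"
  proof -
    have "((4 * pi) powr (n / 2)) powr (1 / q) = 2 powr (n / 2 * (1 - 1 / p)) * (2 * pi) powr (n / 2 * (1 - 1 / p))"
      by (simp add: powr_powr q' powr_mult[symmetric])
    moreover have "(2 * pi) powr (- (n / 2 * (1 - 1 / p))) * (2 * pi) powr (n / 2 * (1 - 1 / p)) = 1"
      by (simp add: powr_add[symmetric])
    moreover have "((\<Prod>i\<in>UNIV. G i) / \<bar>det A\<bar>) powr (1 / p) = (\<Prod>i\<in>UNIV. G i powr (1 / p)) / \<bar>det A\<bar> powr (1 / p)"
      using G0 by (simp add: powr_divide prod_powr_distrib prod_nonneg)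
    ultimately show ?thesis
      by (simp add: K_def)
  qed
  finally show ?thesis
    by (simp only: n_def S_def)
qed

theorem theorem1p2:
  fixes M :: "'a measure"
    and X :: "'a \<Rightarrow> real ^ 'n"
    and \<sigma> :: "'n \<Rightarrow> real"
    and p :: real
    and f :: "'n \<Rightarrow> real \<Rightarrow> complex"
  assumes "prob_space M"
    and "centered_gaussian_vector M X"
    and "\<And>i. \<sigma> i > 0"
    and "\<And>i. (\<integral>\<omega>. (X \<omega> $ i)\<^sup>2 \<partial>M) = (\<sigma> i)\<^sup>2"
    and "positive_definite (covariance_matrix M X)"
    and "p \<ge> 2 * decoupling_coefficient M X"
    and "\<And>i. f i \<in> Lp_real p"
  shows "integrable M (\<lambda>\<omega>. \<Prod>i\<in>UNIV. f i (X \<omega> $ i)) \<and>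
    norm (\<integral>\<omega>. (\<Prod>i\<in>UNIV. f i (X \<omega> $ i)) \<partial>M)
      \<le> 2 powr (real CARD('n) / 2 * (1 - 1 / p)) * (\<Prod>i\<in>UNIV. \<sigma> i) powr (1 / p)
          / det (covariance_matrix M X) powr (1 / (2 * p))
        * (\<Prod>i\<in>UNIV. (\<integral>\<omega>. norm (f i (X \<omega> $ i)) powr p \<partial>M) powr (1 / p))"
proof -
  interpret prob_space M by fact
  define C where "C = covariance_matrix M X"
  note \<sigma> = assms(3)
  have [measurable]: "X \<in> borel_measurable M"
    using assms(2) by (simp add: centered_gaussian_vector_def)
  have fm[measurable]: "f i \<in> borel_measurable borel" and fi: "integrable lborel (\<lambda>x. norm (f i x) powr p)" for i
    using assms(7)[of i] by (auto simp: Lp_real_def)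

  have row: "(\<Sum>j\<in>UNIV. \<bar>C $ i $ j\<bar>) \<le> p / 2 * (\<sigma> i)\<^sup>2" and p: "2 \<le> p" for i
  proof -
    have eq: "(\<Sum>j\<in>UNIV. \<bar>\<integral>\<omega>. X \<omega> $ i * X \<omega> $ j \<partial>M\<bar> / (\<integral>\<omega>. (X \<omega> $ i)\<^sup>2 \<partial>M)) = (\<Sum>j\<in>UNIV. \<bar>C $ i $ j\<bar>) / (\<sigma> i)\<^sup>2"
      by (simp add: C_def covariance_matrix_def assms(4) sum_divide_distrib)
    have "(\<Sum>j\<in>UNIV. \<bar>C $ i $ j\<bar>) / (\<sigma> i)\<^sup>2 \<le> decoupling_coefficient M X"
      unfolding decoupling_coefficient_def eq[symmetric] by (rule Max_ge) auto
    then have le: "(\<Sum>j\<in>UNIV. \<bar>C $ i $ j\<bar>) / (\<sigma> i)\<^sup>2 \<le> p / 2"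
      using assms(6) by linarith
    then show row: "(\<Sum>j\<in>UNIV. \<bar>C $ i $ j\<bar>) \<le> p / 2 * (\<sigma> i)\<^sup>2"
      using \<sigma>[of i] by (simp add: pos_divide_le_eq)
    \<comment> \<open>The diagonal term of the row sum shows that the decoupling coefficient is at least 1.\<close>
    have "(\<sigma> i)\<^sup>2 = \<bar>C $ i $ i\<bar>"
      using assms(4)[of i] by (simp add: C_def covariance_matrix_def power2_eq_square)
    also have "\<dots> \<le> (\<Sum>j\<in>UNIV. \<bar>C $ i $ j\<bar>)"
      by (rule member_le_sum) auto
    finally have "1 * (\<sigma> i)\<^sup>2 \<le> p / 2 * (\<sigma> i)\<^sup>2"
      using row by simp
    then have "1 \<le> p / 2"
      using \<sigma>[of i] by (subst (asm) mult_le_cancel_right_pos) auto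
    then show "2 \<le> p" by simp
  qed

  obtain A :: "real ^ 'n ^ 'n" where A: "A ** transpose A = C" "det A \<noteq> 0"
    and distrX: "distr M borel X = distr std_gaussian borel (\<lambda>y. A *v y)"
    using gaussian_vector_linear_image[OF assms(2,5)] unfolding C_def by blast

  have ell: "(\<Sum>i\<in>UNIV. ((A *v y) $ i)\<^sup>2 / (\<sigma> i)\<^sup>2) \<le> p / 2 * (y \<bullet> y)" for y
  proof (rule weighted_norm_factor_bound)
    fix z
    have "z \<bullet> (C *v z) \<le> (\<Sum>i\<in>UNIV. p / 2 * (\<sigma> i)\<^sup>2 * (z $ i)\<^sup>2)"
      using assms(5) row by (intro quadratic_form_row_sum_bound) (simp_all add: positive_definite_def C_def)
    then show "z \<bullet> ((A ** transpose A) *v z) \<le> p / 2 * (\<Sum>i\<in>UNIV. (\<sigma> i)\<^sup>2 * (z $ i)\<^sup>2)"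
      by (simp add: A sum_distrib_left mult.assoc)
  qed (use \<sigma> p in \<open>auto simp: less_imp_neq[symmetric]\<close>)

  define G where "G i = (\<integral>\<omega>. norm (f i (X \<omega> $ i)) powr p \<partial>M)" for i
  have G0: "0 \<le> G i" for i by (simp add: G_def)
  have G: "(\<integral>\<^sup>+x. ennreal (normal_density 0 (\<sigma> i) x * norm (f i x) powr p) \<partial>lborel) = ennreal (G i)" for i
  proof -
    have "centered_gaussian M (\<lambda>\<omega>. X \<omega> $ i)"
      using centered_gaussian_vector_expectation(1)[OF assms(2), of "axis i 1"] by (simp add: inner_axis')
    then have D: "distributed M lborel (\<lambda>\<omega>. X \<omega> $ i) (normal_density 0 (\<sigma> i))"
      using assms(4) \<sigma> by (rule centered_gaussian_nondegenerate)
    have "integrable lborel (\<lambda>x. normal_density 0 (\<sigma> i) x * norm (f i x) powr p)"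
    proof (rule Bochner_Integration.integrable_bound)
      \<comment> \<open>The density of \<open>X $ i\<close> is bounded, so \<open>L\<^sup>p\<close> for Lebesgue measure suffices for a finite \<open>p\<close>-th moment.\<close>
      show "integrable lborel (\<lambda>x. 1 / sqrt (2 * pi * (\<sigma> i)\<^sup>2) * norm (f i x) powr p)"
        using fi by simp
      have "normal_density 0 (\<sigma> i) x * norm (f i x) powr p
          \<le> 1 / sqrt (2 * pi * (\<sigma> i)\<^sup>2) * norm (f i x) powr p" for x
        unfolding normal_density_def by (intro mult_right_mono mult_left_le) auto
      then show "AE x in lborel. norm (normal_density 0 (\<sigma> i) x * norm (f i x) powr p)
          \<le> norm (1 / sqrt (2 * pi * (\<sigma> i)\<^sup>2) * norm (f i x) powr p)"
        by (intro AE_I2) (simp add: abs_mult)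
    qed simp
    then have "(\<integral>\<^sup>+x. ennreal (normal_density 0 (\<sigma> i) x * norm (f i x) powr p) \<partial>lborel)
        = ennreal (\<integral>x. normal_density 0 (\<sigma> i) x * norm (f i x) powr p \<partial>lborel)"
      by (intro nn_integral_eq_integral) auto
    also have "(\<integral>x. normal_density 0 (\<sigma> i) x * norm (f i x) powr p \<partial>lborel) = G i"
      unfolding G_def by (rule distributed_integral[OF D]) auto
    finally show ?thesis .
  qed

  let ?R = "2 powr (real CARD('n) / 2 * (1 - 1 / p)) * (\<Prod>i\<in>UNIV. \<sigma> i) powr (1 / p)
          / det C powr (1 / (2 * p)) * (\<Prod>i\<in>UNIV. G i powr (1 / p))"
  have "det C = \<bar>det A\<bar> powr 2"
    using A(2) by (simp add: A(1)[symmetric] det_mul det_transpose power2_eq_square)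
  then have detC: "det C powr (1 / (2 * p)) = \<bar>det A\<bar> powr (1 / p)"
    by (simp only: powr_powr) simp
  have "(\<integral>\<^sup>+\<omega>. ennreal (norm (\<Prod>i\<in>UNIV. f i (X \<omega> $ i))) \<partial>M)
      = (\<integral>\<^sup>+x. ennreal (\<Prod>i\<in>UNIV. norm (f i (x $ i))) \<partial>distr M borel X)"
    by (simp add: nn_integral_distr prod_norm)
  also have "\<dots> = (\<integral>\<^sup>+y. ennreal (\<Prod>i\<in>UNIV. norm (f i ((A *v y) $ i))) \<partial>std_gaussian)"
    unfolding distrX by (simp add: nn_integral_distr)
  also have "\<dots> \<le> ennreal ?R"
    unfolding detC using p by (intro nn_integral_std_gaussian_prod_le \<sigma> ell A(2) G0 G) auto
  finally have bound: "(\<integral>\<^sup>+\<omega>. ennreal (norm (\<Prod>i\<in>UNIV. f i (X \<omega> $ i))) \<partial>M) \<le> ennreal ?R" .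
  have int: "integrable M (\<lambda>\<omega>. \<Prod>i\<in>UNIV. f i (X \<omega> $ i))"
    using bound by (intro integrableI_bounded) (auto simp: le_less_trans)
  have "ennreal (norm (\<integral>\<omega>. (\<Prod>i\<in>UNIV. f i (X \<omega> $ i)) \<partial>M)) \<le> ennreal ?R"
    using integral_norm_bound_ennreal[OF int] bound by (rule order_trans)
  moreover have "0 \<le> ?R"
    by (auto intro!: mult_nonneg_nonneg divide_nonneg_nonneg prod_nonneg)
  ultimately have "norm (\<integral>\<omega>. (\<Prod>i\<in>UNIV. f i (X \<omega> $ i)) \<partial>M) \<le> ?R"
    by (simp only: ennreal_le_iff)
  with int show ?thesis
    by (simp only: G_def C_def simp_thms)
qed

end
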